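(* For all integers $d \ge 2$ and $k$ with $d+3 \le k \le 2d$ there exists a constant $C > 0$ (depending on $d$ and $k$) such that for all integers $n \ge k$, $$\Delta_{k,d}(n) \le C\, n^{-\left(1-\frac{1}{k-d-1}\right)\left(\log \frac{d}{k-d-1} - 1.1\right)}.$$
   Context: For integers $k \ge d+1$ and $n \ge k$, $\Delta_{k,d}(n)$ denotes the minimum number $\Delta$ such that among any $n$ (distinct) points in $[0,1]^d$ there are $k$ points whose convex hull has $d$-dimensional volume at most $\Delta$. $\log$ is the natural logarithm. *)

theory Defs imports "HOL-Analysis.Analysis" begin

definition small_hull_bound :: "'d::finite itself \<Rightarrow> nat \<Rightarrow> nat \<Rightarrow> real \<Rightarrow> bool" where
  "small_hull_bound (_ :: 'd itself) k n \<Delta> \<longleftrightarrow>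
     (\<forall>P :: (real ^ 'd) set. finite P \<and> card P = n \<and> P \<subseteq> cbox 0 1 \<longrightarrow>
        (\<exists>Q\<subseteq>P. card Q = k \<and> measure lebesgue (convex hull Q) \<le> \<Delta>))"

text \<open>The quantity \<open>\<Delta>\<^bsub>k,d\<^esub>(n)\<close> is \<open>heilbronn TYPE('d) k n\<close> with \<open>d = CARD('d)\<close>. For \<open>k \<le> n\<close>
  the minimum exists: see \<open>heilbronn_least\<close>.\<close>

definition heilbronn :: "'d::finite itself \<Rightarrow> nat \<Rightarrow> nat \<Rightarrow> real" where
  "heilbronn T k n = (LEAST \<Delta>. small_hull_bound T k n \<Delta>)"

lemma heilbronn_least:
  assumes "k \<le> n"
  shows "small_hull_bound TYPE('d::finite) k n (heilbronn TYPE('d) k n)"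
    and "small_hull_bound TYPE('d) k n \<Delta> \<Longrightarrow> heilbronn TYPE('d) k n \<le> \<Delta>"
proof -
  define S where "S = {\<Delta>. small_hull_bound TYPE('d) k n \<Delta>}"
  define V where "V P = {measure lebesgue (convex hull Q) | Q. Q \<subseteq> P \<and> card Q = k}"
    for P :: "(real ^ 'd) set"
  have V_fin: "finite (V P)" if "finite P" for P
  proof -
    have "V P \<subseteq> (\<lambda>Q. measure lebesgue (convex hull Q)) ` Pow P" by (auto simp: V_def)
    then show ?thesis using that finite_subset by blast
  qed
  have V_ne: "V P \<noteq> {}" if "finite P" "card P = n" for P
  proof -
    have "k \<le> card P" using that assms by simp
    then obtain Q where "Q \<subseteq> P" "card Q = k" by (rule obtain_subset_with_card_n)
    then show ?thesis by (auto simp: V_def)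
  qed
  have S_iff: "\<Delta> \<in> S \<longleftrightarrow> (\<forall>P. finite P \<and> card P = n \<and> P \<subseteq> cbox 0 1 \<longrightarrow> Min (V P) \<le> \<Delta>)" for \<Delta>
  proof -
    have "(\<exists>Q\<subseteq>P. card Q = k \<and> measure lebesgue (convex hull Q) \<le> \<Delta>) \<longleftrightarrow> Min (V P) \<le> \<Delta>"
      if "finite P" "card P = n" for P
      unfolding Min_le_iff[OF V_fin[OF that(1)] V_ne[OF that]] by (auto simp: V_def)
    then show ?thesis unfolding S_def small_hull_bound_def by blast
  qed
  have "infinite (cbox 0 1 :: (real ^ 'd) set)"
  proof -
    have "box 0 (1 :: real ^ 'd) \<noteq> {}"
      by (simp add: interval_ne_empty_cart)
    then have "infinite (box 0 1 :: (real ^ 'd) set)"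
      using finite_imp_not_open open_box by blast
    then show ?thesis using box_subset_cbox finite_subset by blast
  qed
  then obtain P0 :: "(real ^ 'd) set" where P0: "finite P0" "card P0 = n" "P0 \<subseteq> cbox 0 1"
    using infinite_arbitrarily_large by blast
  then have bdd: "bdd_below S" unfolding bdd_below_def using S_iff by blast
  have "1 \<in> S"
  proof -
    have "\<exists>Q\<subseteq>P. card Q = k \<and> measure lebesgue (convex hull Q) \<le> 1"
      if P: "finite P" "card P = n" "P \<subseteq> cbox 0 1" for P :: "(real ^ 'd) set"
    proof -
      obtain Q where Q: "Q \<subseteq> P" "card Q = k"
        using obtain_subset_with_card_n[of k P] P(2) assms by auto
      have sub: "convex hull Q \<subseteq> cbox 0 1"
        using Q(1) P(3) by (intro hull_minimal) auto
      have "compact (convex hull Q)"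
        using Q(1) P(1) finite_subset finite_imp_compact_convex_hull by blast
      then have "measure lebesgue (convex hull Q) \<le> measure lebesgue (cbox 0 1 :: (real ^ 'd) set)"
        using sub by (intro measure_mono_fmeasurable)
          (auto simp: lmeasurable_compact fmeasurableD)
      also have "\<dots> \<le> 1"
        by (simp add: content_cbox_cart interval_ne_empty_cart)
      finally show ?thesis using Q by blast
    qed
    then show ?thesis unfolding S_def small_hull_bound_def by blast
  qed
  then have ne: "S \<noteq> {}" by blast
  have "Inf S \<in> S"
    unfolding S_iff using S_iff by (auto intro!: cInf_greatest[OF ne])
  then have "small_hull_bound TYPE('d) k n (Inf S)" by (simp add: S_def)
  moreover have "Inf S \<le> \<Delta>" if "small_hull_bound TYPE('d) k n \<Delta>" for \<Delta>
    using that bdd by (auto simp: S_def intro: cInf_lower)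
  ultimately have eq: "heilbronn TYPE('d) k n = Inf S"
    unfolding heilbronn_def by (intro Least_equality) auto
  show "small_hull_bound TYPE('d) k n (heilbronn TYPE('d) k n)"
    unfolding eq by fact
  show "small_hull_bound TYPE('d) k n \<Delta> \<Longrightarrow> heilbronn TYPE('d) k n \<le> \<Delta>"
    unfolding eq using bdd by (auto simp: S_def intro: cInf_lower)
qed

end

theory Submission imports Defs begin

text \<open>Write \<open>m = k - d - 1\<close>. The \<open>k\<close> points are chosen in consecutive blocks. Suppose \<open>a\<close> points have been chosen.
Their affine hull has dimension at most \<open>a - 1\<close>; enlarge its direction space to a subspace \<open>U\<close> of dimension
exactly \<open>a - 1\<close> and project the remaining points of \<open>P\<close> along \<open>U\<close> into dimension \<open>r = d + 1 - a\<close>. By the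
pigeonhole principle the projection has a cluster, of any prescribed bounded size, of diameter
\<open>O(n powr (-1/r))\<close>, and this cluster is the next block. The smaller \<open>r\<close> has become, the tighter the cluster
(\<open>cluster_near_flat\<close>, \<open>flag_configuration_exists\<close>).

The hull of the chosen points is covered by its \<open>d\<close>-simplices, so it is enough to bound the volume of every simplex,
and each simplex omits only \<open>m\<close> of the points. List its vertices in the order of choice and take the matrix of
consecutive differences in an orthonormal basis adapted to the growing subspaces \<open>U\<close>. This matrix vanishes above a
shifted diagonal, and a difference within one block is tiny outside \<open>U\<close>. In any nonzero term of the Leibniz formula
a block of \<open>b\<close> points therefore contributes at least \<open>b - (m + 1)\<close> tiny factors: at most \<open>m\<close> rows are lost
through the omitted points and one through the passage from the previous block (\<open>card_close_rows\<close>,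
\<open>leibniz_term_bound\<close>). Hence the volume is \<open>O(n powr (-V))\<close> with
\<open>V = (\<Sum> (b - (m + 1)) / r)\<close>, the sum ranging over the blocks (\<open>heilbronn_le_of_block_exponent\<close>).

What remains is to choose the block sizes. Reading the blocks from the last one backwards, let the number \<open>r\<close> of
remaining homogeneous coordinates run through \<open>(m + 1) * j * (j + 3) / 2\<close>; the block leading from step \<open>j + 1\<close>
down to step \<open>j\<close> has \<open>(m + 1) * (j + 2)\<close> points and gains \<open>2 / (j + 4)\<close>. These gains add up to
\<open>2 ln j \<approx> ln (d / m)\<close> up to a constant. The growth of the blocks is forced by two competing losses: a block
of \<open>b\<close> points wastes the share \<open>(m + 1) / b\<close> of its points, and it uses the scale at its beginning although
\<open>r\<close> improves by \<open>b\<close> along the way; both are of the order \<open>1 / j\<close> times the gain when \<open>b\<close> is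
about the square root of \<open>2 * (m + 1) * r\<close>, so that the total loss stays bounded. The rest is the verification that
the accumulated constant is good enough (\<open>block_exponent_target\<close>).\<close>

section \<open>Lebesgue measure under linear maps\<close>

text \<open>Both sides are multiplicative in \<open>f\<close>, so it suffices to treat coordinate scalings, swaps, shears and singular maps.
Swaps and shears have determinant of modulus one and preserve the content of boxes.\<close>

lemma measure_linear_image_cart:
  fixes f :: "real ^ 'd::finite \<Rightarrow> real ^ 'd"
  assumes "linear f" "S \<in> lmeasurable"
  shows "f ` S \<in> lmeasurable \<and> measure lebesgue (f ` S) = \<bar>det (matrix f)\<bar> * measure lebesgue S"
proof -
  define scales where "scales g \<longleftrightarrow> (\<forall>S\<in>lmeasurable. g ` S \<in> lmeasurable \<and>
      measure lebesgue (g ` S) = \<bar>det (matrix g)\<bar> * measure lebesgue S)" for g :: "real ^ 'd \<Rightarrow> real ^ 'd"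
  have unimodular: "scales g"
    if "linear g" "\<bar>det (matrix g)\<bar> = 1"
      and box: "\<And>a b. cbox a b \<noteq> {} \<Longrightarrow> measure lebesgue (g ` cbox a b) = measure lebesgue (cbox a b)" for g
  proof -
    have "measure lebesgue (g ` cbox a b) = 1 * measure lebesgue (cbox a b)" for a b
      using box[of a b] by (cases "cbox a b = {}") auto
    then have "g ` S \<in> lmeasurable \<and> measure lebesgue (g ` S) = measure lebesgue S"
      if "S \<in> lmeasurable" for S
      using measure_linear_sufficient[OF \<open>linear g\<close> that, of 1] by simp
    then show ?thesis using that(2) by (simp add: scales_def)
  qed
  have "scales f"
  proof (rule induct_linear_elementary[OF assms(1)])
    fix f g :: "real ^ 'd \<Rightarrow> real ^ 'd"
    assume lin: "linear f" "linear g" and fg: "scales f" "scales g"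
    have det: "\<bar>det (matrix (f \<circ> g))\<bar> = \<bar>det (matrix f)\<bar> * \<bar>det (matrix g)\<bar>"
      using matrix_compose[OF lin(2,1)] by (simp add: det_mul abs_mult)
    show "scales (f \<circ> g)" unfolding scales_def
    proof (intro ballI)
      fix S :: "(real ^ 'd) set"
      assume "S \<in> lmeasurable"
      then have g: "g ` S \<in> lmeasurable" "measure lebesgue (g ` S) = \<bar>det (matrix g)\<bar> * measure lebesgue S"
        using fg(2) by (simp_all add: scales_def)
      then have "f ` (g ` S) \<in> lmeasurable"
        "measure lebesgue (f ` (g ` S)) = \<bar>det (matrix f)\<bar> * measure lebesgue (g ` S)"
        using fg(1) unfolding scales_def by blast+
      then show "(f \<circ> g) ` S \<in> lmeasurable \<and>
          measure lebesgue ((f \<circ> g) ` S) = \<bar>det (matrix (f \<circ> g))\<bar> * measure lebesgue S"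
        unfolding det g(2) image_comp by simp
    qed
  next
    fix f :: "real ^ 'd \<Rightarrow> real ^ 'd" and i
    assume f: "linear f" "\<And>x. f x $ i = 0"
    have "axis i 1 \<notin> range f"
    proof
      assume "axis i 1 \<in> range f"
      then obtain x where "f x = axis i 1" by auto
      then show False using f(2)[of x] by simp
    qed
    then have "\<not> inj f" using linear_injective_imp_surjective[OF f(1)] by blast
    then have "det (matrix f) = 0" "negligible (f ` S)" for S
      using f(1) det_nz_iff_inj negligible_linear_singular_image by blast+
    then show "scales f"
      by (simp add: scales_def negligible_iff_measure)
  next
    fix c :: "'d \<Rightarrow> real"
    have "matrix (\<lambda>x. \<chi> i. c i * x $ i) = (\<chi> i j. if i = j then c i else 0)"
      by (auto simp: matrix_def axis_def vec_eq_iff)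
    then have "det (matrix (\<lambda>x. \<chi> i. c i * x $ i)) = prod c UNIV"
      by (simp add: det_diagonal)
    then show "scales (\<lambda>x. \<chi> i. c i * x $ i)"
      by (simp add: scales_def measurable_stretch measure_stretch)
  next
    fix m n :: 'd
    assume "m \<noteq> n"
    let ?\<tau> = "Transposition.transpose m n"
    let ?h = "\<lambda>x :: real ^ 'd. \<chi> i. x $ ?\<tau> i"
    have \<tau>: "?\<tau> permutes UNIV" by (simp add: permutes_swap_id)
    have lin: "linear ?h" by (rule linearI) (simp_all add: vec_eq_iff)
    have "?h v \<bullet> ?h w = v \<bullet> w" for v w
      using sum.permute[OF \<tau>, of "\<lambda>i. v $ i * w $ i"] by (simp add: inner_vec_def o_def)
    then have "orthogonal_transformation ?h" using lin by (simp add: orthogonal_transformation_def)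
    then have det: "\<bar>det (matrix ?h)\<bar> = 1" by (rule orthogonal_transformation_det)
    show "scales ?h"
    proof (rule unimodular[OF lin det])
      fix a b :: "real ^ 'd"
      assume ne: "cbox a b \<noteq> {}"
      have "?h ` cbox a b = cbox (?h a) (?h b)"
      proof
        show "cbox (?h a) (?h b) \<subseteq> ?h ` cbox a b"
        proof
          fix x assume x: "x \<in> cbox (?h a) (?h b)"
          have "a $ i \<le> x $ ?\<tau> i \<and> x $ ?\<tau> i \<le> b $ i" for i
            using x[unfolded mem_box_cart, rule_format, of "?\<tau> i"] by simp
          then have "?h x \<in> cbox a b" by (simp add: mem_box_cart)
          moreover have "x = ?h (?h x)" by (simp add: vec_eq_iff)
          ultimately show "x \<in> ?h ` cbox a b" by blast
        qed
      qed (auto simp: mem_box_cart)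
      moreover have "cbox (?h a) (?h b) \<noteq> {}" using ne calculation by force
      ultimately show "measure lebesgue (?h ` cbox a b) = measure lebesgue (cbox a b)"
        using ne prod.permute[OF \<tau>, of "\<lambda>i. b $ i - a $ i"]
        by (simp add: content_cbox_cart o_def)
    qed
  next
    fix m n :: 'd
    assume mn: "m \<noteq> n"
    let ?h = "\<lambda>x :: real ^ 'd. \<chi> i. if i = m then x $ m + x $ n else x $ i"
    have lin: "linear ?h" by (rule linearI) (auto simp: vec_eq_iff algebra_simps)
    have "matrix ?h = (\<chi> k. if k = m then row m (mat 1) + 1 *s row n (mat 1) else row k (mat 1))"
      by (auto simp: matrix_def row_def mat_def axis_def vec_eq_iff)
    then have det: "\<bar>det (matrix ?h)\<bar> = 1"
      using det_row_operation[OF mn, of "mat 1 :: real ^ 'd ^ 'd" 1] by simp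
    show "scales ?h"
    proof (rule unimodular[OF lin det])
      fix a b :: "real ^ 'd"
      assume ne: "cbox a b \<noteq> {}"
      \<comment> \<open>The content of a sheared box is known only if a coordinate of the box starts at a nonnegative value; translate the corner to \<open>0\<close>.\<close>
      have shift: "cbox a b = (+) a ` cbox 0 (b - a)"
        using cbox_translation[of a 0 "b - a"] by simp
      have "?h ` cbox a b = (+) (?h a) ` ?h ` cbox 0 (b - a)"
        unfolding shift image_comp by (intro image_cong) (auto simp: linear_add[OF lin])
      moreover have "cbox 0 (b - a) \<noteq> {}" using ne unfolding shift by blast
      ultimately have "measure lebesgue (?h ` cbox a b) = measure lebesgue (cbox 0 (b - a))"
        using measure_shear_interval[OF mn, of 0 "b - a"] by (simp add: measure_translation)
      then show "measure lebesgue (?h ` cbox a b) = measure lebesgue (cbox a b)"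
        unfolding shift by (simp only: measure_translation)
    qed
  qed
  then show ?thesis using assms(2) by (simp add: scales_def)
qed

section \<open>Orthonormal frames\<close>

definition orthonormal_frame :: "(nat \<Rightarrow> real ^ 'd::finite) \<Rightarrow> bool" where
  "orthonormal_frame e \<longleftrightarrow>
     (\<forall>i<CARD('d). \<forall>j<CARD('d). e i \<bullet> e j = (if i = j then 1 else 0))"

lemma orthonormal_frame_exists: "\<exists>e :: nat \<Rightarrow> real ^ 'd::finite. orthonormal_frame e"
proof -
  obtain h :: "nat \<Rightarrow> 'd" where h: "bij_betw h {0..<CARD('d)} UNIV"
    using ex_bij_betw_nat_finite[of "UNIV :: 'd set"] by auto
  have "orthonormal_frame (\<lambda>i. axis (h i) 1)"
    using h unfolding orthonormal_frame_def bij_betw_def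
    by (auto simp: inner_axis_axis inj_on_def)
  then show ?thesis by blast
qed

lemma orthonormal_frame_expand:
  fixes e :: "nat \<Rightarrow> real ^ 'd::finite"
  assumes "orthonormal_frame e"
  shows "x \<bullet> u = (\<Sum>i<CARD('d). (x \<bullet> e i) * (u \<bullet> e i))"
proof -
  let ?B = "e ` {..<CARD('d)}"
  have ee: "e i \<bullet> e j = (if i = j then 1 else 0)" if "i < CARD('d)" "j < CARD('d)" for i j
    using assms that unfolding orthonormal_frame_def by blast
  have inj: "inj_on e {..<CARD('d)}"
  proof (rule inj_onI)
    fix i j assume "i \<in> {..<CARD('d)}" "j \<in> {..<CARD('d)}" "e i = e j"
    then show "i = j" using ee[of i j] ee[of i i] by (auto split: if_splits)
  qed
  have orth: "pairwise orthogonal ?B"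
    unfolding pairwise_def orthogonal_def using ee by auto
  have nz: "0 \<notin> ?B"
  proof
    assume "0 \<in> ?B"
    then obtain i where "i < CARD('d)" "e i = 0" by auto
    then show False using ee[of i i] by simp
  qed
  have ind: "independent ?B" using pairwise_orthogonal_independent[OF orth nz] .
  have "card ?B = CARD('d)" using card_image[OF inj] by simp
  then have "UNIV \<subseteq> span ?B"
    by (intro card_ge_dim_independent ind) (auto simp: dim_UNIV)
  then have "u \<in> span ?B" by auto
  then have "(\<Sum>b\<in>?B. (u \<bullet> b) *\<^sub>R b) = u"
    by (intro orthonormal_basis_expand orth) (auto simp: ee norm_eq_1)
  then have "u = (\<Sum>i<CARD('d). (u \<bullet> e i) *\<^sub>R e i)"
    using sum.reindex[OF inj, of "\<lambda>b. (u \<bullet> b) *\<^sub>R b"] by (simp add: o_def)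
  then have "x \<bullet> u = x \<bullet> (\<Sum>i<CARD('d). (u \<bullet> e i) *\<^sub>R e i)" by simp
  also have "\<dots> = (\<Sum>i<CARD('d). (x \<bullet> e i) * (u \<bullet> e i))"
    by (simp add: inner_sum_right mult.commute)
  finally show ?thesis .
qed

text \<open>The vector \<open>v\<close> enters the span of the first \<open>N + 1\<close> frame vectors after a Householder reflection that
exchanges \<open>e N\<close> with the normalised part of \<open>v\<close> orthogonal to \<open>e 0, \<dots>, e (N - 1)\<close>. The reflection
fixes these \<open>N\<close> vectors and keeps the frame complete. The membership in the span is expressed through its orthogonal
complement, which is the form in which matrix entries are shown to vanish.\<close>

lemma orthonormal_frame_absorb:
  fixes e :: "nat \<Rightarrow> real ^ 'd::finite"
  assumes e: "orthonormal_frame e" and N: "N < CARD('d)"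
  shows "\<exists>e'. orthonormal_frame e' \<and> (\<forall>j<N. e' j = e j) \<and>
    (\<forall>u. (\<forall>j\<le>N. u \<bullet> e' j = 0) \<longrightarrow> v \<bullet> u = 0)"
proof -
  define \<rho> where "\<rho> = v - (\<Sum>j<N. (v \<bullet> e j) *\<^sub>R e j)"
  have ee: "e i \<bullet> e j = (if i = j then 1 else 0)" if "i < CARD('d)" "j < CARD('d)" for i j
    using e that unfolding orthonormal_frame_def by blast
  have \<rho>_orth: "\<rho> \<bullet> e i = 0" if "i < N" for i
  proof -
    have "(\<Sum>j<N. (v \<bullet> e j) * (e j \<bullet> e i)) = (\<Sum>j<N. if j = i then v \<bullet> e i else 0)"
      using that N by (intro sum.cong) (auto simp: ee)
    then show ?thesis
      using that by (simp add: \<rho>_def inner_diff_left inner_sum_left)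
  qed
  have vu: "v \<bullet> u = \<rho> \<bullet> u" if "\<forall>j<N. u \<bullet> e j = 0" for u
  proof -
    have "e j \<bullet> u = 0" if "j < N" for j
      using that \<open>\<forall>j<N. u \<bullet> e j = 0\<close> by (simp add: inner_commute)
    then show ?thesis by (simp add: \<rho>_def inner_diff_left inner_sum_left)
  qed
  show ?thesis
  proof (cases "\<rho> = 0")
    case True
    then show ?thesis using e vu by (intro exI[of _ e]) auto
  next
    case False
    define w where "w = \<rho> /\<^sub>R norm \<rho>"
    have ww: "w \<bullet> w = 1"
      using False by (simp add: w_def dot_square_norm power2_eq_square)
    have w_orth: "w \<bullet> e i = 0" if "i < N" for i
      using \<rho>_orth[OF that] by (simp add: w_def)
    define z where "z = e N - w"
    define H where "H y = y - (2 * (y \<bullet> z) / (z \<bullet> z)) *\<^sub>R z" for y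
    have H_inner: "H a \<bullet> H b = a \<bullet> b" for a b
    proof (cases "z = 0")
      case False
      define c where "c = 2 / (z \<bullet> z)"
      have c: "c * (z \<bullet> z) = 2" using False by (simp add: c_def)
      have H_eq: "H y = y - (c * (y \<bullet> z)) *\<^sub>R z" for y by (simp add: H_def c_def)
      have "H a \<bullet> H b = a \<bullet> b - 2 * (c * (a \<bullet> z) * (b \<bullet> z))
          + (c * (z \<bullet> z)) * (c * (a \<bullet> z) * (b \<bullet> z))"
        unfolding H_eq inner_diff_left inner_diff_right inner_scaleR_left inner_scaleR_right
          inner_commute[of z b] by algebra
      then show ?thesis unfolding c by simp
    qed (simp add: H_def)
    have H_fix: "H (e j) = e j" if "j < N" for j
    proof -
      have "e j \<bullet> w = 0" using w_orth[OF that] by (simp add: inner_commute)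
      moreover have "e j \<bullet> e N = 0" using that N by (simp add: ee)
      ultimately show ?thesis by (simp add: H_def z_def inner_diff_right)
    qed
    have H_N: "H (e N) = w"
    proof (cases "z = 0")
      case False
      have "e N \<bullet> e N = 1" using N by (simp add: ee)
      then have zz: "z \<bullet> z = 2 * (e N \<bullet> z)"
        unfolding z_def inner_diff_left inner_diff_right ww inner_commute[of w "e N"] by simp
      have "2 * (e N \<bullet> z) / (z \<bullet> z) = 1"
        unfolding zz[symmetric] using False by simp
      then have "H (e N) = e N - z" by (simp only: H_def scaleR_one)
      then show ?thesis by (simp add: z_def)
    qed (simp add: H_def z_def)
    have "orthonormal_frame (\<lambda>j. H (e j))"
      using ee by (simp add: orthonormal_frame_def H_inner)
    moreover have "v \<bullet> u = 0" if u: "\<forall>j\<le>N. u \<bullet> H (e j) = 0" for u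
    proof -
      have "u \<bullet> w = 0" using u H_N by auto
      moreover have "\<rho> = norm \<rho> *\<^sub>R w" using False by (simp add: w_def)
      ultimately have "\<rho> \<bullet> u = 0" by (metis inner_commute inner_scaleR_right mult_zero_right)
      moreover have "\<forall>j<N. u \<bullet> e j = 0" using u H_fix by (metis less_imp_le)
      ultimately show ?thesis using vu by simp
    qed
    ultimately show ?thesis using H_fix by (intro exI[of _ "\<lambda>j. H (e j)"]) auto
  qed
qed

text \<open>The case \<open>i \<ge> CARD('d)\<close> is included: then the whole frame is orthogonal to \<open>u\<close>, which forces \<open>u = 0\<close>.
This happens for the last block, which has more points than there are dimensions left.\<close>

lemma orthonormal_frame_absorb_many:
  fixes e :: "nat \<Rightarrow> real ^ 'd::finite"
  assumes e: "orthonormal_frame e"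
  shows "\<exists>e'. orthonormal_frame e' \<and> (\<forall>j<N. e' j = e j) \<and>
    (\<forall>i. N \<le> i \<and> i < N + c \<longrightarrow>
      (\<forall>u. (\<forall>j<CARD('d). j \<le> i \<longrightarrow> u \<bullet> e' j = 0) \<longrightarrow> v i \<bullet> u = 0))"
proof (induction c)
  case 0
  then show ?case using e by (intro exI[of _ e]) auto
next
  case (Suc c)
  then obtain e' where e': "orthonormal_frame e'" "\<And>j. j < N \<Longrightarrow> e' j = e j"
    "\<And>i u. N \<le> i \<Longrightarrow> i < N + c \<Longrightarrow> (\<forall>j<CARD('d). j \<le> i \<longrightarrow> u \<bullet> e' j = 0) \<Longrightarrow> v i \<bullet> u = 0"
    by blast
  show ?case
  proof (cases "N + c < CARD('d)")
    case True
    obtain e'' where e'': "orthonormal_frame e''" "\<And>j. j < N + c \<Longrightarrow> e'' j = e' j"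
      "\<And>u. (\<forall>j\<le>N + c. u \<bullet> e'' j = 0) \<Longrightarrow> v (N + c) \<bullet> u = 0"
      using orthonormal_frame_absorb[OF e'(1) True, of "v (N + c)"] by blast
    have "v i \<bullet> u = 0" if i: "N \<le> i" "i < N + Suc c"
      and u: "\<forall>j<CARD('d). j \<le> i \<longrightarrow> u \<bullet> e'' j = 0" for i u
    proof (cases "i = N + c")
      case False
      then show ?thesis using e'(3)[of i u] i u e''(2) True by auto
    qed (use u True e''(3) in auto)
    then show ?thesis using e'(2) e''(1,2) by (intro exI[of _ e'']) auto
  next
    case False
    have "v i \<bullet> u = 0" if i: "N \<le> i" "i < N + Suc c"
      and u: "\<forall>j<CARD('d). j \<le> i \<longrightarrow> u \<bullet> e' j = 0" for i u
    proof (cases "i = N + c")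
      case True
      then show ?thesis
        using u False orthonormal_frame_expand[OF e'(1), of "v i" u] by auto
    qed (use u i e'(3) in auto)
    then show ?thesis using e'(1,2) by (intro exI[of _ e']) auto
  qed
qed

section \<open>Clusters modulo a subspace\<close>

lemma norm_unit_cube_le:
  fixes x :: "real ^ 'd::finite"
  assumes "x \<in> cbox 0 1"
  shows "norm x \<le> real CARD('d)"
proof -
  have "norm x \<le> (\<Sum>i\<in>UNIV. \<bar>x $ i\<bar>)" by (rule norm_le_l1_cart)
  also have "\<dots> \<le> (\<Sum>i\<in>(UNIV::'d set). 1)"
    using assms by (intro sum_mono) (auto simp: mem_box_cart)
  finally show ?thesis by simp
qed

text \<open>Coordinates of points of the cube lie in \<open>(-K, K)\<close> with \<open>K = d + 1\<close>. Cut the range of each of the at most \<open>r\<close>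
coordinates from \<open>N\<close> on into \<open>q \<approx> (n / k) powr (1 / r)\<close> intervals. There are at most \<open>n / k\<close> cells,
so one of them contains \<open>a\<close> points of \<open>P - X\<close>; the estimate holds for every \<open>n \<ge> k\<close> because
\<open>X\<close> and the new block together have at most \<open>k\<close> elements.\<close>

lemma cluster_in_slab:
  fixes P X :: "(real ^ 'd::finite) set" and e :: "nat \<Rightarrow> real ^ 'd"
  assumes e: "orthonormal_frame e"
    and P: "finite P" "P \<subseteq> cbox 0 1" "k \<le> card P" "k > 0"
    and X: "X \<subseteq> P" "card X + a \<le> k"
    and r: "r > 0" "CARD('d) \<le> N + r"
  defines "\<delta> \<equiv> 4 * (CARD('d) + 1) * k * real (card P) powr (- (1 / real r))"
  shows "\<exists>C\<subseteq>P - X. card C = a \<and>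
    (\<forall>x\<in>C. \<forall>y\<in>C. \<forall>j. N \<le> j \<and> j < CARD('d) \<longrightarrow> \<bar>(x - y) \<bullet> e j\<bar> \<le> \<delta>)"
proof (cases "a = 0")
  case True
  then show ?thesis by (intro exI[of _ "{}"]) auto
next
  case False
  define n where "n = card P"
  have n: "n \<ge> k" "n > 0" using P by (auto simp: n_def)
  define K where "K = real CARD('d) + 1"
  define q where "q = nat \<lfloor>(real n / real k) powr (1 / real r)\<rfloor>"
  let ?J = "{N..<CARD('d)}"
  define B where "B = ?J \<rightarrow>\<^sub>E {..<q}"
  have ge1: "1 \<le> (real n / real k) powr (1 / real r)"
    using n P(4) by (intro ge_one_powr_ge_zero) auto
  then have q1: "q \<ge> 1" by (simp add: q_def le_nat_floor)
  have q_le: "real q \<le> (real n / real k) powr (1 / real r)"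
    using ge1 by (simp add: q_def)
  \<comment> \<open>Rounding down at most halves a number that is at least one; this is where the constant 4 comes from.\<close>
  have q_gt: "(real n / real k) powr (1 / real r) < 2 * real q"
    using q1 by (simp add: q_def) linarith
  have cardB: "real (card B) * real k \<le> real n"
  proof -
    have "real (card B) = real q ^ card ?J" by (simp add: B_def card_PiE)
    also have "\<dots> \<le> real q ^ r" using q1 r by (intro power_increasing) auto
    also have "\<dots> \<le> ((real n / real k) powr (1 / real r)) ^ r"
      using q_le by (intro power_mono) auto
    also have "\<dots> = real n / real k"
      using r(1) n P(4) by (simp add: powr_power)
    finally show ?thesis using P(4) by (simp add: field_simps)
  qed
  define f where "f x = (\<lambda>j\<in>?J. nat \<lfloor>(x \<bullet> e j + K) * q / (2 * K)\<rfloor>)" for x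
  have coord: "\<bar>x \<bullet> e j\<bar> < K" if "x \<in> P" "j < CARD('d)" for x j
  proof -
    have "norm (e j) = 1" using e that by (simp add: orthonormal_frame_def norm_eq_1)
    then have "\<bar>x \<bullet> e j\<bar> \<le> norm x" using Cauchy_Schwarz_ineq2[of x "e j"] by simp
    also have "\<dots> < K" using norm_unit_cube_le[of x] that P by (auto simp: K_def)
    finally show ?thesis .
  qed
  have cell: "0 \<le> (x \<bullet> e j + K) * q / (2 * K)" "(x \<bullet> e j + K) * q / (2 * K) < q"
    if "x \<in> P" "j < CARD('d)" for x j
  proof -
    have c: "0 < x \<bullet> e j + K" "x \<bullet> e j + K < 2 * K" using coord[OF that] by auto
    then show "0 \<le> (x \<bullet> e j + K) * q / (2 * K)" by simp
    have "(x \<bullet> e j + K) * q < (2 * K) * q" using c q1 by (intro mult_strict_right_mono) auto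
    then show "(x \<bullet> e j + K) * q / (2 * K) < q" using c by (simp add: field_simps)
  qed
  have fB: "f \<in> (P - X) \<rightarrow> B"
    using cell by (auto simp: f_def B_def nat_less_iff floor_less_iff)
  have B: "finite B" "B \<noteq> {}" using q1 by (auto simp: B_def PiE_eq_empty_iff lessThan_empty_iff intro!: finite_PiE)
  obtain y where y: "y \<in> B" "card (P - X) \<le> card (f -` {y} \<inter> (P - X)) * card B"
    using pigeonhole_card[OF fB _ B] P(1) by auto
  have "a \<le> card (f -` {y} \<inter> (P - X))"
  proof (rule ccontr)
    assume "\<not> ?thesis"
    then have "card (f -` {y} \<inter> (P - X)) \<le> a - 1" by simp
    then have "card (P - X) \<le> (a - 1) * card B"
      using y(2) by (meson le_trans mult_le_mono1)
    moreover have "card (P - X) = n - card X"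
      using X(1) P(1) by (simp add: n_def card_Diff_subset finite_subset)
    ultimately have "n - card X \<le> (a - 1) * card B" by simp
    then have "(n - card X) * k \<le> (a - 1) * (card B * k)"
      by (metis mult.assoc mult_le_mono1)
    also have "\<dots> \<le> (a - 1) * n"
      using cardB by (intro mult_le_mono2) (simp flip: of_nat_mult)
    finally have "(n - card X) * k \<le> (a - 1) * n" .
    then have "n * k \<le> (a - 1) * n + card X * k"
      by (simp add: diff_mult_distrib)
    also have "\<dots> \<le> (a - 1) * n + card X * n" using n(1) by simp
    also have "\<dots> = (a - 1 + card X) * n" by (simp add: algebra_simps)
    finally have "k \<le> a - 1 + card X" using n(2) by (simp add: mult.commute)
    then show False using X(2) False by simp
  qed
  then obtain C where C: "C \<subseteq> f -` {y} \<inter> (P - X)" "card C = a"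
    by (meson obtain_subset_with_card_n)
  have "\<bar>(u - v) \<bullet> e j\<bar> \<le> \<delta>" if uv: "u \<in> C" "v \<in> C" and j: "N \<le> j" "j < CARD('d)" for u v j
  proof -
    have in_P: "u \<in> P" "v \<in> P" using uv C by auto
    have "f u = y" "f v = y" using uv C(1) by auto
    then have "f u j = f v j" by simp
    then have "nat \<lfloor>(u \<bullet> e j + K) * q / (2 * K)\<rfloor> = nat \<lfloor>(v \<bullet> e j + K) * q / (2 * K)\<rfloor>"
      using j by (simp add: f_def)
    then have "\<lfloor>(u \<bullet> e j + K) * q / (2 * K)\<rfloor> = \<lfloor>(v \<bullet> e j + K) * q / (2 * K)\<rfloor>"
      using cell(1)[OF in_P(1) j(2)] cell(1)[OF in_P(2) j(2)] by (simp add: eq_nat_nat_iff)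
    then have "\<bar>(u \<bullet> e j + K) * q / (2 * K) - (v \<bullet> e j + K) * q / (2 * K)\<bar> < 1"
      by linarith
    also have "(u \<bullet> e j + K) * q / (2 * K) - (v \<bullet> e j + K) * q / (2 * K) = (u - v) \<bullet> e j * (q / (2 * K))"
      by (simp add: inner_diff_left algebra_simps flip: diff_divide_distrib)
    finally have "\<bar>(u - v) \<bullet> e j\<bar> * (q / (2 * K)) < 1"
      by (simp add: abs_mult K_def)
    then have "\<bar>(u - v) \<bullet> e j\<bar> < 2 * K / q" using q1 by (simp add: field_simps K_def)
    also have "\<dots> \<le> 2 * K / ((real n / real k) powr (1 / real r) / 2)"
      using q_gt ge1 q1 n P(4) by (intro divide_left_mono mult_pos_pos) (auto simp: K_def)
    also have "\<dots> = 4 * K * (real k powr (1 / real r) * real n powr (- (1 / real r)))"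
      using n P(4) by (simp add: powr_divide powr_minus field_simps)
    also have "\<dots> \<le> 4 * K * (real k powr 1 * real n powr (- (1 / real r)))"
      using P(4) r(1) by (intro mult_left_mono mult_right_mono powr_mono) (auto simp: K_def)
    finally show ?thesis using P(4) by (simp add: \<delta>_def K_def n_def mult_ac add_ac)
  qed
  then show ?thesis using C by (intro exI[of _ C]) auto
qed

text \<open>A bound on the coordinates from \<open>N\<close> on bounds the component along every unit vector orthogonal to
\<open>e 0, \<dots>, e (N - 1)\<close>. Only this form of closeness survives when the frame vectors from \<open>N\<close> on are replaced
at a later stage.\<close>

lemma cluster_near_flat:
  fixes P X :: "(real ^ 'd::finite) set" and e :: "nat \<Rightarrow> real ^ 'd"
  assumes e: "orthonormal_frame e"
    and P: "finite P" "P \<subseteq> cbox 0 1" "k \<le> card P" "k > 0"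
    and X: "X \<subseteq> P" "card X + a \<le> k"
    and r: "r > 0" "CARD('d) \<le> N + r"
  defines "\<delta> \<equiv> 4 * CARD('d) * (CARD('d) + 1) * k * real (card P) powr (- (1 / real r))"
  shows "\<exists>C\<subseteq>P - X. card C = a \<and>
    (\<forall>x\<in>C. \<forall>y\<in>C. \<forall>u. norm u = 1 \<and> (\<forall>j<N. j < CARD('d) \<longrightarrow> u \<bullet> e j = 0) \<longrightarrow> \<bar>(x - y) \<bullet> u\<bar> \<le> \<delta>)"
proof -
  define \<eta> where "\<eta> = 4 * (CARD('d) + 1) * k * real (card P) powr (- (1 / real r))"
  obtain C where C: "C \<subseteq> P - X" "card C = a"
    and close: "\<And>x y j. x \<in> C \<Longrightarrow> y \<in> C \<Longrightarrow> N \<le> j \<Longrightarrow> j < CARD('d) \<Longrightarrow> \<bar>(x - y) \<bullet> e j\<bar> \<le> \<eta>"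
    using cluster_in_slab[OF e P X r] unfolding \<eta>_def by blast
  have "\<bar>(x - y) \<bullet> u\<bar> \<le> \<delta>"
    if xy: "x \<in> C" "y \<in> C" and u: "norm u = 1" "\<forall>j<N. j < CARD('d) \<longrightarrow> u \<bullet> e j = 0" for x y u
  proof -
    have "\<bar>(x - y) \<bullet> u\<bar> \<le> (\<Sum>i<CARD('d). \<bar>((x - y) \<bullet> e i) * (u \<bullet> e i)\<bar>)"
      unfolding orthonormal_frame_expand[OF e, of "x - y" u] by (rule sum_abs)
    also have "\<dots> \<le> (\<Sum>i<CARD('d). \<eta>)"
    proof (intro sum_mono)
      fix i assume i: "i \<in> {..<CARD('d)}"
      have \<eta>: "\<eta> \<ge> 0" by (simp add: \<eta>_def)
      show "\<bar>((x - y) \<bullet> e i) * (u \<bullet> e i)\<bar> \<le> \<eta>"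
      proof (cases "i < N")
        case True
        then show ?thesis using u i \<eta> by simp
      next
        case False
        have "norm (e i) = 1" using e i by (simp add: orthonormal_frame_def norm_eq_1)
        then have "\<bar>u \<bullet> e i\<bar> \<le> 1" using Cauchy_Schwarz_ineq2[of u "e i"] u by simp
        moreover have "\<bar>(x - y) \<bullet> e i\<bar> \<le> \<eta>" using close[OF xy] False i by simp
        ultimately have "\<bar>(x - y) \<bullet> e i\<bar> * \<bar>u \<bullet> e i\<bar> \<le> \<eta> * 1"
          using \<eta> by (intro mult_mono) auto
        then show ?thesis by (simp add: abs_mult)
      qed
    qed
    also have "\<dots> = \<delta>" by (simp add: \<eta>_def \<delta>_def mult_ac)
    finally show ?thesis .
  qed
  then show ?thesis using C by (intro exI[of _ C]) auto
qed

section \<open>Configurations adapted to a flag\<close>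

text \<open>After \<open>a \<ge> 1\<close> chosen points the projection has dimension \<open>d + 1 - a\<close>. For \<open>a = 0\<close> the dimension is
\<open>d\<close>, and the formula gives a slightly weaker scale, which keeps the cases uniform.\<close>

definition block_scale :: "nat \<Rightarrow> nat \<Rightarrow> nat \<Rightarrow> real" where
  "block_scale n d a = real n powr (- (1 / (real (d + 1) - real a)))"

lemma block_scale_bounds:
  assumes "n > 0" "a \<le> d"
  shows "0 < block_scale n d a" "block_scale n d a \<le> 1"
proof -
  show "0 < block_scale n d a" using assms by (simp add: block_scale_def)
  have "real n powr (- (1 / (real (d + 1) - real a))) \<le> real n powr 0"
    using assms by (intro powr_mono) (auto simp: divide_nonneg_pos)
  then show "block_scale n d a \<le> 1" using assms by (simp add: block_scale_def)
qed

text \<open>Block \<open>l\<close> consists of the points \<open>x i\<close> with \<open>A l \<le> i < A (Suc l)\<close>. The first condition says that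
\<open>x i - x 0\<close> lies in the span of \<open>e 0, \<dots>, e (i - 1)\<close>; the second that the points of a block are within
\<open>c * s l\<close> of each other modulo the span of the first \<open>A l - 1\<close> frame vectors, the subspace that contains all
differences of earlier points.\<close>

definition flag_configuration ::
  "real \<Rightarrow> (nat \<Rightarrow> real) \<Rightarrow> (nat \<Rightarrow> nat) \<Rightarrow> nat \<Rightarrow> (nat \<Rightarrow> real ^ 'd::finite) \<Rightarrow> (nat \<Rightarrow> real ^ 'd) \<Rightarrow> bool" where
  "flag_configuration c s A t x e \<longleftrightarrow> orthonormal_frame e \<and>
     (\<forall>i<A t. \<forall>u. (\<forall>j<CARD('d). j < i \<longrightarrow> u \<bullet> e j = 0) \<longrightarrow> (x i - x 0) \<bullet> u = 0) \<and>
     (\<forall>l<t. \<forall>i\<in>{A l..<A (Suc l)}. \<forall>i'\<in>{A l..<A (Suc l)}. \<forall>u.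
        norm u = 1 \<and> (\<forall>j<A l - 1. j < CARD('d) \<longrightarrow> u \<bullet> e j = 0) \<longrightarrow> \<bar>(x i - x i') \<bullet> u\<bar> \<le> c * s l)"

text \<open>Blocks are added one at a time. The new block is a cluster modulo the first \<open>A t - 1\<close> frame vectors; these are kept,
and the later ones are adjusted to absorb the differences of the new points. Earlier closeness statements mention only
frame vectors that are kept.\<close>

lemma flag_configuration_exists:
  fixes P :: "(real ^ 'd::finite) set"
  assumes P: "finite P" "P \<subseteq> cbox 0 1" "k \<le> card P" "k > 0"
    and A: "mono A" "A 0 = 0" "\<And>l. l < t \<Longrightarrow> A l \<le> CARD('d)" "A t \<le> k"
  defines "c \<equiv> 4 * real CARD('d) * (real CARD('d) + 1) * real k"
  shows "\<exists>x e. inj_on x {..<A t} \<and> x ` {..<A t} \<subseteq> P \<and>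
    flag_configuration c (\<lambda>l. block_scale (card P) CARD('d) (A l)) A t x (e :: nat \<Rightarrow> real ^ 'd)"
  using A(3,4)
proof (induction t)
  case 0
  obtain e :: "nat \<Rightarrow> real ^ 'd" where "orthonormal_frame e" using orthonormal_frame_exists by blast
  then show ?case using A(2) by (intro exI[of _ "\<lambda>_. 0"] exI[of _ e]) (simp add: flag_configuration_def)
next
  case (Suc t)
  let ?s = "\<lambda>l. block_scale (card P) CARD('d) (A l)"
  have At: "A t \<le> A (Suc t)" using A(1) by (simp add: monoD)
  obtain x and e :: "nat \<Rightarrow> real ^ 'd" where x: "inj_on x {..<A t}" "x ` {..<A t} \<subseteq> P"
    and conf: "flag_configuration c ?s A t x e"
    using Suc.IH Suc.prems At by auto
  have e: "orthonormal_frame e"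
    and old0: "\<And>i u. i < A t \<Longrightarrow> (\<forall>j<CARD('d). j < i \<longrightarrow> u \<bullet> e j = 0) \<Longrightarrow> (x i - x 0) \<bullet> u = 0"
    and old1: "\<And>l i i' u. l < t \<Longrightarrow> i \<in> {A l..<A (Suc l)} \<Longrightarrow> i' \<in> {A l..<A (Suc l)} \<Longrightarrow> norm u = 1 \<Longrightarrow>
      (\<forall>j<A l - 1. j < CARD('d) \<longrightarrow> u \<bullet> e j = 0) \<Longrightarrow> \<bar>(x i - x i') \<bullet> u\<bar> \<le> c * ?s l"
    using conf unfolding flag_configuration_def by blast+
  define N where "N = A t - 1"
  define r where "r = CARD('d) + 1 - A t"
  have Atd: "A t \<le> CARD('d)" using Suc.prems(1) by simp
  have r: "r > 0" "CARD('d) \<le> N + r" using Atd by (auto simp: r_def N_def)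
  have card_x: "card (x ` {..<A t}) + (A (Suc t) - A t) \<le> k"
    using card_image[OF x(1)] Suc.prems(2) At by simp
  obtain C where C: "C \<subseteq> P - x ` {..<A t}" "card C = A (Suc t) - A t"
    and close: "\<And>y z u. y \<in> C \<Longrightarrow> z \<in> C \<Longrightarrow> norm u = 1 \<Longrightarrow>
        (\<forall>j<N. j < CARD('d) \<longrightarrow> u \<bullet> e j = 0) \<Longrightarrow> \<bar>(y - z) \<bullet> u\<bar> \<le>
        4 * CARD('d) * (CARD('d) + 1) * k * real (card P) powr (- (1 / real r))"
    using cluster_near_flat[OF e P x(2) card_x r] by blast
  have scale: "4 * CARD('d) * (CARD('d) + 1) * k * real (card P) powr (- (1 / real r)) = c * ?s t"
    using Atd by (simp add: c_def block_scale_def r_def of_nat_diff algebra_simps)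
  have "finite C" using C(1) P(1) finite_subset by blast
  then obtain g where g: "bij_betw g {0..<A (Suc t) - A t} C"
    using ex_bij_betw_nat_finite[of C] C(2) by auto
  define x' where "x' i = (if i < A t then x i else g (i - A t))" for i
  have x'_new: "x' i \<in> C" if "A t \<le> i" "i < A (Suc t)" for i
    using that bij_betwE[OF g] by (auto simp: x'_def)
  obtain e' where e': "orthonormal_frame e'" "\<And>j. j < N \<Longrightarrow> e' j = e j"
    and absorb: "\<And>i u. N \<le> i \<Longrightarrow> i < N + A (Suc t) \<Longrightarrow>
      (\<forall>j<CARD('d). j \<le> i \<longrightarrow> u \<bullet> e' j = 0) \<Longrightarrow> (x' (Suc i) - x' 0) \<bullet> u = 0"
    using orthonormal_frame_absorb_many[OF e, of N "A (Suc t)" "\<lambda>i. x' (Suc i) - x' 0"] by blast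
  have x'_old: "x' i \<notin> C" if "i < A t" for i
    using that C(1) by (auto simp: x'_def)
  have inj: "inj_on x' {..<A (Suc t)}"
  proof (rule inj_onI)
    fix i j assume ij: "i \<in> {..<A (Suc t)}" "j \<in> {..<A (Suc t)}" "x' i = x' j"
    consider "i < A t" "j < A t" | "i < A t" "A t \<le> j" | "A t \<le> i" "j < A t" | "A t \<le> i" "A t \<le> j"
      by linarith
    then show "i = j"
    proof cases
      case 1
      then show ?thesis using ij x(1) by (auto simp: x'_def inj_on_def)
    next
      case 2
      then show ?thesis using ij x'_new[of j] x'_old[of i] by simp
    next
      case 3
      then show ?thesis using ij x'_new[of i] x'_old[of j] by simp
    next
      case 4
      then have "i - A t = j - A t"
        using ij by (intro inj_onD[OF bij_betw_imp_inj_on[OF g]]) (auto simp: x'_def)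
      then show ?thesis using 4 by linarith
    qed
  qed
  have sub: "x' ` {..<A (Suc t)} \<subseteq> P"
  proof safe
    fix i assume "i < A (Suc t)"
    then show "x' i \<in> P"
      using x'_new[of i] C(1) x(2) by (cases "i < A t") (auto simp: x'_def)
  qed
  have span: "(x' i - x' 0) \<bullet> u = 0"
    if i: "i < A (Suc t)" and u: "\<forall>j<CARD('d). j < i \<longrightarrow> u \<bullet> e' j = 0" for i u
  proof (cases "i < A t")
    case True
    have "\<forall>j<CARD('d). j < i \<longrightarrow> u \<bullet> e j = 0"
      using u True e'(2) by (auto simp: N_def)
    then show ?thesis using old0[OF True, of u] True by (simp add: x'_def)
  next
    case False
    show ?thesis
    proof (cases i)
      case (Suc i')
      then show ?thesis using absorb[of i' u] False i u by (auto simp: N_def less_Suc_eq_le)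
    qed simp
  qed
  have small: "\<bar>(x' i - x' i') \<bullet> u\<bar> \<le> c * ?s l"
    if l: "l < Suc t" and i: "i \<in> {A l..<A (Suc l)}" "i' \<in> {A l..<A (Suc l)}"
      and u: "norm u = 1" "\<forall>j<A l - 1. j < CARD('d) \<longrightarrow> u \<bullet> e' j = 0" for l i i' u
  proof (cases "l = t")
    case True
    have "\<forall>j<N. j < CARD('d) \<longrightarrow> u \<bullet> e j = 0" using u(2) e'(2) True by (auto simp: N_def)
    then show ?thesis
      using close[of "x' i" "x' i'" u] x'_new i u(1) True scale by auto
  next
    case False
    then have "l < t" using l by simp
    have mono: "A l \<le> A t" "A (Suc l) \<le> A t" using \<open>l < t\<close> A(1) by (auto simp: monoD)
    have "\<forall>j<A l - 1. j < CARD('d) \<longrightarrow> u \<bullet> e j = 0"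
      using u(2) e'(2) mono by (auto simp: N_def)
    then show ?thesis using old1[OF \<open>l < t\<close> i u(1)] i mono by (simp add: x'_def)
  qed
  have "flag_configuration c ?s A (Suc t) x' e'"
    unfolding flag_configuration_def using e'(1) span small by blast
  then show ?case using inj sub by blast
qed

section \<open>Volumes of simplices in a configuration\<close>

text \<open>The numbers \<open>y 0 < \<dots> < y d\<close> are the positions of the vertices of a simplex, \<open>p\<close> stands for the row
\<open>x (y (Suc p)) - x (y p)\<close> and \<open>\<sigma> p\<close> for the column used in a Leibniz term. The set counts the rows inside
the block \<open>[a, b)\<close> whose column is beyond \<open>a - 1\<close>. Since at most \<open>m\<close> positions are omitted, at least
\<open>b - (m + 1)\<close> rows end before \<open>b\<close>. Of these, the rows ending before \<open>a\<close> and the rows with a column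
below \<open>a - 1\<close> compete for the same \<open>a - 1\<close> columns, and at most one row crosses \<open>a\<close>.\<close>

lemma card_close_rows:
  fixes y \<sigma> :: "nat \<Rightarrow> nat"
  assumes y: "strict_mono_on {..d} y" "y d < d + 1 + m"
    and \<sigma>: "inj_on \<sigma> {..<d}" "\<And>p. p < d \<Longrightarrow> \<sigma> p < y (Suc p)"
    and ab: "a \<le> b" "b \<le> d + 1 + m"
  shows "b - a - (m + 1) \<le> card {p. p < d \<and> a \<le> y p \<and> y (Suc p) < b \<and> a - 1 \<le> \<sigma> p}"
proof -
  have y_step: "y p < y (Suc p)" if "p < d" for p
    using y(1) that by (auto simp: strict_mono_on_def)
  have y_top: "y p + j \<le> y (p + j)" if "p + j \<le> d" for p j
    using that
  proof (induction j)
    case (Suc j)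
    then show ?case using y_step[of "p + j"] by simp
  qed simp
  have y_le: "y p \<le> p + m" if "p \<le> d" for p
    using y_top[of p "d - p"] that y(2) by simp
  have y_mono: "y p < y q" if "p < q" "q \<le> d" for p q
    using y(1) that by (auto simp: strict_mono_on_def)
  define small where "small = {p. p < d \<and> a \<le> y p \<and> y (Suc p) < b \<and> a - 1 \<le> \<sigma> p}"
  define low where "low = {p. p < d \<and> y p < a \<and> y (Suc p) < a} \<union> {p. p < d \<and> a \<le> y p \<and> \<sigma> p < a - 1}"
  define cross where "cross = {p. p < d \<and> y p < a \<and> a \<le> y (Suc p)}"
  have "{..<b - (m + 1)} \<subseteq> small \<union> (low \<union> cross)"
  proof
    fix p assume p: "p \<in> {..<b - (m + 1)}"
    then have "p < d" using ab(2) by auto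
    moreover have "y (Suc p) < b" using p y_le[of "Suc p"] \<open>p < d\<close> by auto
    ultimately have "p < d" "y (Suc p) < b" by auto
    then show "p \<in> small \<union> (low \<union> cross)" by (auto simp: small_def low_def cross_def)
  qed
  then have "b - (m + 1) \<le> card (small \<union> (low \<union> cross))"
    using card_mono[of "small \<union> (low \<union> cross)" "{..<b - (m + 1)}"]
    by (simp add: small_def low_def cross_def)
  also have "\<dots> \<le> card small + (card low + card cross)"
    using card_Un_le[of small "low \<union> cross"] card_Un_le[of low cross] by linarith
  finally have cover: "b - (m + 1) \<le> card small + (card low + card cross)" .
  have "card low + card cross \<le> a"
  proof (cases "a = 0")
    case True
    then show ?thesis by (simp add: low_def cross_def)
  next
    case False
    have "\<sigma> ` low \<subseteq> {..<a - 1}" using \<sigma>(2) by (fastforce simp: low_def)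
    moreover have "inj_on \<sigma> low" by (rule inj_on_subset[OF \<sigma>(1)]) (auto simp: low_def)
    ultimately have "card low \<le> card {..<a - 1}" by (intro card_inj_on_le) auto
    moreover have "card cross \<le> 1"
    proof (rule card_le_Suc0_iff_eq[THEN iffD2, unfolded One_nat_def[symmetric]])
      have "\<not> p < q" if "p \<in> cross" "q \<in> cross" for p q
        using that y_mono[of "Suc p" q] by (cases "Suc p = q") (auto simp: cross_def)
      then show "\<forall>p\<in>cross. \<forall>q\<in>cross. p = q" by (metis linorder_neqE_nat)
    qed (simp add: cross_def)
    ultimately show ?thesis using False by simp
  qed
  then show ?thesis using cover unfolding small_def by linarith
qed

text \<open>A term is zero unless \<open>\<sigma> p < y (Suc p)\<close> for all rows, because of the flag condition. All entries are at most
\<open>c\<close>, and the rows counted in \<open>card_close_rows\<close> have entries at most \<open>c * s l\<close>.\<close>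

lemma leibniz_term_bound:
  fixes z e :: "nat \<Rightarrow> real ^ 'd::finite"
  assumes conf: "flag_configuration c s A t x e"
    and s: "\<And>l. l < t \<Longrightarrow> 0 \<le> s l \<and> s l \<le> 1" and c: "c > 0"
    and A: "mono A" "A t = CARD('d) + 1 + m"
    and y: "strict_mono_on {..CARD('d)} y" "y CARD('d) < A t"
    and diam: "\<And>i i'. i < A t \<Longrightarrow> i' < A t \<Longrightarrow> norm (x i - x i') \<le> c"
    and \<sigma>: "\<sigma> ` {..<CARD('d)} \<subseteq> {..<CARD('d)}" "inj_on \<sigma> {..<CARD('d)}"
  shows "(\<Prod>p<CARD('d). \<bar>(x (y (Suc p)) - x (y p)) \<bullet> e (\<sigma> p)\<bar>) \<le>
    c ^ CARD('d) * (\<Prod>l<t. s l ^ (A (Suc l) - A l - (m + 1)))"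
proof -
  define d where "d = CARD('d)"
  define G where "G p = \<bar>(x (y (Suc p)) - x (y p)) \<bullet> e (\<sigma> p)\<bar>" for p
  have e: "orthonormal_frame e"
    and flag: "\<And>i u. i < A t \<Longrightarrow> (\<forall>j<d. j < i \<longrightarrow> u \<bullet> e j = 0) \<Longrightarrow> (x i - x 0) \<bullet> u = 0"
    and near: "\<And>l i i' u. l < t \<Longrightarrow> i \<in> {A l..<A (Suc l)} \<Longrightarrow> i' \<in> {A l..<A (Suc l)} \<Longrightarrow> norm u = 1 \<Longrightarrow>
      (\<forall>j<A l - 1. j < d \<longrightarrow> u \<bullet> e j = 0) \<Longrightarrow> \<bar>(x i - x i') \<bullet> u\<bar> \<le> c * s l"
    using conf unfolding flag_configuration_def d_def by blast+
  have ee: "e i \<bullet> e j = (if i = j then 1 else 0)" if "i < d" "j < d" for i j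
    using e that unfolding orthonormal_frame_def d_def by blast
  have e_norm: "norm (e j) = 1" if "j < d" for j using ee[OF that that] by (simp add: norm_eq_1)
  have \<sigma>_less: "\<sigma> p < d" if "p < d" for p using \<sigma>(1) that by (auto simp: d_def)
  have y_step: "y p < y (Suc p)" if "p < d" for p
    using y(1) that by (auto simp: strict_mono_on_def d_def)
  have y_less: "y p < A t" if "p \<le> d" for p
  proof -
    have "y p \<le> y d"
      using y(1) that strict_mono_onD[OF y(1), of p d] by (cases "p = d") (auto simp: d_def)
    then show ?thesis using y(2) by (simp add: d_def)
  qed
  have rhs: "0 \<le> c ^ d * (\<Prod>l<t. s l ^ (A (Suc l) - A l - (m + 1)))"
    using s c by (intro mult_nonneg_nonneg prod_nonneg) auto
  show ?thesis
  proof (cases "\<exists>p<d. y (Suc p) \<le> \<sigma> p")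
    case True
    then obtain p where p: "p < d" "y (Suc p) \<le> \<sigma> p" by blast
    have "(x i - x 0) \<bullet> e (\<sigma> p) = 0" if "i \<le> y (Suc p)" for i
      using that p y_less[of "Suc p"] \<sigma>_less[OF p(1)] by (intro flag) (auto simp: ee)
    from this[of "y (Suc p)"] this[of "y p"] have "G p = 0"
      using y_step[OF p(1)] by (simp add: G_def inner_diff_left)
    then have "(\<Prod>p<d. G p) = 0" using p(1) by auto
    then show ?thesis using rhs unfolding G_def d_def by linarith
  next
    case False
    then have \<sigma>_y: "\<sigma> p < y (Suc p)" if "p < d" for p using that by force
    define S where "S l = {p. p < d \<and> A l \<le> y p \<and> y (Suc p) < A (Suc l) \<and> A l - 1 \<le> \<sigma> p}" for l
    have cardS: "A (Suc l) - A l - (m + 1) \<le> card (S l)" if "l < t" for l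
    proof -
      have "A (Suc l) \<le> d + 1 + m" using monoD[OF A(1), of "Suc l" t] that A(2) by (simp add: d_def)
      moreover have "A l \<le> A (Suc l)" using A(1) by (simp add: monoD)
      ultimately show ?thesis unfolding S_def
        using y \<sigma>(2) A(2) \<sigma>_y by (intro card_close_rows) (auto simp: d_def)
    qed
    have disj: "S l \<inter> S l' = {}" if "l < l'" for l l'
    proof -
      have "A (Suc l) \<le> A l'" using A(1) that by (simp add: monoD)
      then show ?thesis using y_step by (fastforce simp: S_def)
    qed
    define g where "g p = G p / c" for p
    have g0: "0 \<le> g p" for p using c by (simp add: g_def G_def)
    have g1: "g p \<le> 1" if "p < d" for p
    proof -
      have "G p \<le> norm (x (y (Suc p)) - x (y p)) * norm (e (\<sigma> p))"
        unfolding G_def by (rule Cauchy_Schwarz_ineq2)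
      also have "\<dots> \<le> c"
        using e_norm[OF \<sigma>_less[OF that]] diam[of "y (Suc p)" "y p"] y_less[of p] y_less[of "Suc p"] that
        by simp
      finally show ?thesis using c by (simp add: g_def)
    qed
    have gS: "g p \<le> s l" if "l < t" "p \<in> S l" for l p
    proof -
      have p: "p < d" "A l \<le> y p" "y (Suc p) < A (Suc l)" "A l - 1 \<le> \<sigma> p"
        using that(2) by (auto simp: S_def)
      have "G p \<le> c * s l" unfolding G_def
        using p y_step[OF p(1)] \<sigma>_less[OF p(1)]
        by (intro near[OF that(1)]) (auto simp: ee e_norm)
      then show ?thesis using c by (simp add: g_def field_simps)
    qed
    have "(\<Prod>p<d. g p) = (\<Prod>p\<in>(\<Union>l<t. S l). g p) * (\<Prod>p\<in>{..<d} - (\<Union>l<t. S l). g p)"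
      by (subst mult.commute, rule prod.subset_diff) (auto simp: S_def)
    also have "\<dots> \<le> (\<Prod>p\<in>(\<Union>l<t. S l). g p) * 1"
      using g0 g1 by (intro mult_left_mono prod_le_1 prod_nonneg) auto
    also have "(\<Prod>p\<in>(\<Union>l<t. S l). g p) = (\<Prod>l<t. \<Prod>p\<in>S l. g p)"
    proof (rule prod.UNION_disjoint)
      show "\<forall>l\<in>{..<t}. finite (S l)" by (simp add: S_def)
      show "\<forall>l\<in>{..<t}. \<forall>l'\<in>{..<t}. l \<noteq> l' \<longrightarrow> S l \<inter> S l' = {}"
        using disj by (metis Int_commute linorder_neqE_nat)
    qed simp
    also have "\<dots> \<le> (\<Prod>l<t. s l ^ (A (Suc l) - A l - (m + 1)))"
    proof (intro prod_mono conjI)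
      fix l assume l: "l \<in> {..<t}"
      have "(\<Prod>p\<in>S l. g p) \<le> (\<Prod>p\<in>S l. s l)" using g0 gS l by (intro prod_mono) auto
      also have "\<dots> \<le> s l ^ (A (Suc l) - A l - (m + 1))"
        using s[of l] cardS[of l] l by (simp add: power_decreasing)
      finally show "(\<Prod>p\<in>S l. g p) \<le> s l ^ (A (Suc l) - A l - (m + 1))" .
    qed (use g0 in \<open>auto intro!: prod_nonneg\<close>)
    finally have "(\<Prod>p<d. g p) \<le> (\<Prod>l<t. s l ^ (A (Suc l) - A l - (m + 1)))" by simp
    then have "c ^ d * (\<Prod>p<d. g p) \<le> c ^ d * (\<Prod>l<t. s l ^ (A (Suc l) - A l - (m + 1)))"
      using c by (intro mult_left_mono) auto
    also have "c ^ d * (\<Prod>p<d. g p) = (\<Prod>p<d. G p)"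
      using c by (simp add: g_def prod_dividef)
    finally show ?thesis by (simp add: G_def d_def)
  qed
qed

text \<open>With nonnegative weights the coefficients of the consecutive differences lie in \<open>[0, 1]\<close>, so a simplex is contained
in the parallelepiped spanned by the steps along its vertices.\<close>

lemma sum_steps_abel:
  fixes z :: "nat \<Rightarrow> 'a::real_vector"
  assumes "sum u {..d} = 1"
  shows "(\<Sum>p\<le>d. u p *\<^sub>R z p) = z 0 + (\<Sum>p<d. (\<Sum>q\<in>{Suc p..d}. u q) *\<^sub>R (z (Suc p) - z p))"
proof -
  have "(\<Sum>p\<le>d. u p *\<^sub>R z p) = (\<Sum>p\<le>d. u p *\<^sub>R z 0) + (\<Sum>p\<le>d. u p *\<^sub>R (z p - z 0))"
    by (simp add: scaleR_diff_right sum_subtractf)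
  also have "(\<Sum>p\<le>d. u p *\<^sub>R z 0) = z 0" using assms by (simp flip: scaleR_sum_left)
  also have "(\<Sum>p\<le>d. u p *\<^sub>R (z p - z 0)) = (\<Sum>p\<le>d. \<Sum>q<p. u p *\<^sub>R (z (Suc q) - z q))"
    by (simp add: sum_lessThan_telescope flip: scaleR_sum_right)
  also have "\<dots> = (\<Sum>q<d. \<Sum>p\<in>{Suc q..d}. u p *\<^sub>R (z (Suc q) - z q))"
    by (rule sum.nested_swap')
  finally show ?thesis by (simp add: scaleR_sum_left)
qed

lemma measure_simplex_le_det:
  fixes z :: "nat \<Rightarrow> real ^ 'd::finite" and h :: "'d \<Rightarrow> nat"
  assumes h: "bij_betw h UNIV {..<CARD('d)}" and inj: "inj_on z {..CARD('d)}"
  shows "measure lebesgue (convex hull (z ` {..CARD('d)})) \<le>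
    \<bar>det (\<chi> p. z (Suc (h p)) - z (h p))\<bar>"
proof -
  define M where "M = (\<chi> p. z (Suc (h p)) - z (h p))"
  define L where "L w = transpose M *v w" for w :: "real ^ 'd"
  have lin: "linear L" unfolding L_def by (rule matrix_vector_mul_linear)
  have matL: "matrix L = transpose M" unfolding L_def by (rule matrix_of_matrix_vector_mul)
  have L_sum: "L w = (\<Sum>p\<in>UNIV. w $ p *\<^sub>R (z (Suc (h p)) - z (h p)))" for w
    by (simp add: L_def M_def vec_eq_iff matrix_vector_mult_def transpose_def mult.commute)
  have sub: "convex hull (z ` {..CARD('d)}) \<subseteq> (+) (z 0) ` L ` cbox 0 1"
  proof
    fix v assume "v \<in> convex hull (z ` {..CARD('d)})"
    then obtain u' where u': "\<forall>x\<in>z ` {..CARD('d)}. 0 \<le> u' x" "sum u' (z ` {..CARD('d)}) = 1"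
      "(\<Sum>x\<in>z ` {..CARD('d)}. u' x *\<^sub>R x) = v"
      by (auto simp: convex_hull_finite)
    define u where "u p = u' (z p)" for p
    have u: "\<And>p. p \<le> CARD('d) \<Longrightarrow> 0 \<le> u p" "sum u {..CARD('d)} = 1"
      "(\<Sum>p\<le>CARD('d). u p *\<^sub>R z p) = v"
      using u' by (auto simp: u_def sum.reindex[OF inj] o_def)
    define w :: "real ^ 'd" where "w = (\<chi> p. \<Sum>q\<in>{Suc (h p)..CARD('d)}. u q)"
    have "w \<in> cbox 0 1"
    proof -
      have "0 \<le> w $ p \<and> w $ p \<le> 1" for p
      proof -
        have "(\<Sum>q\<in>{Suc (h p)..CARD('d)}. u q) \<le> sum u {..CARD('d)}"
          using u(1) by (intro sum_mono2) auto
        then show ?thesis using u by (auto simp: w_def intro!: sum_nonneg)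
      qed
      then show ?thesis by (simp add: mem_box_cart)
    qed
    moreover have "v = z 0 + L w"
      unfolding u(3)[symmetric] sum_steps_abel[OF u(2)] L_sum w_def
      using sum.reindex_bij_betw[OF h, of "\<lambda>p. (\<Sum>q\<in>{Suc p..CARD('d)}. u q) *\<^sub>R (z (Suc p) - z p)"]
      by simp
    ultimately show "v \<in> (+) (z 0) ` L ` cbox 0 1" by blast
  qed
  have meas: "L ` cbox 0 1 \<in> lmeasurable"
    and content: "measure lebesgue (L ` cbox 0 1) = \<bar>det (matrix L)\<bar> * measure lebesgue (cbox 0 (1 :: real ^ 'd))"
    using measure_linear_image_cart[OF lin, of "cbox 0 1"] by auto
  have "measure lebesgue (convex hull (z ` {..CARD('d)})) \<le> measure lebesgue ((+) (z 0) ` L ` cbox 0 1)"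
    using sub meas
    by (intro measure_mono_fmeasurable)
      (auto simp: measurable_translation intro!: fmeasurableD lmeasurable_compact finite_imp_compact_convex_hull)
  also have "\<dots> = measure lebesgue (L ` cbox 0 1)" by (rule measure_translation)
  also have "\<dots> = \<bar>det (matrix L)\<bar> * measure lebesgue (cbox 0 (1 :: real ^ 'd))" by (rule content)
  also have "\<dots> = \<bar>det M\<bar>"
    by (simp add: matL det_transpose content_cbox_cart interval_ne_empty_cart)
  finally show ?thesis unfolding M_def .
qed

text \<open>By the theorem of Caratheodory the hull is the union of its \<open>d\<close>-simplices.\<close>

lemma measure_convex_hull_le_simplices:
  fixes Q :: "(real ^ 'd::finite) set"
  assumes Q: "finite Q" "CARD('d) + 1 \<le> card Q"
    and B: "\<And>S. S \<subseteq> Q \<Longrightarrow> card S = CARD('d) + 1 \<Longrightarrow> measure lebesgue (convex hull S) \<le> B"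
  shows "measure lebesgue (convex hull Q) \<le> 2 ^ card Q * B"
proof -
  define \<S> where "\<S> = {S. S \<subseteq> Q \<and> card S = CARD('d) + 1}"
  have fin: "finite \<S>" using Q(1) by (simp add: \<S>_def)
  have meas: "convex hull S \<in> lmeasurable" if "S \<subseteq> Q" for S
    using that Q(1) by (intro lmeasurable_compact finite_imp_compact_convex_hull) (rule finite_subset)
  have sub: "convex hull Q \<subseteq> (\<Union>S\<in>\<S>. convex hull S)"
  proof
    fix v assume "v \<in> convex hull Q"
    then obtain T where T: "finite T" "T \<subseteq> Q" "card T \<le> CARD('d) + 1" "v \<in> convex hull T"
      unfolding caratheodory[of Q] by auto
    then obtain S where S: "T \<subseteq> S" "S \<subseteq> Q" "card S = CARD('d) + 1"
      using exists_subset_between[of T "CARD('d) + 1" Q] Q by auto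
    then have "v \<in> convex hull S" using T(4) hull_mono by blast
    then show "v \<in> (\<Union>S\<in>\<S>. convex hull S)" using S by (auto simp: \<S>_def)
  qed
  have "0 \<le> B"
  proof -
    obtain S where "S \<subseteq> Q" "card S = CARD('d) + 1"
      using obtain_subset_with_card_n[OF Q(2)] by blast
    then show ?thesis using B[of S] measure_nonneg[of lebesgue "convex hull S"] by linarith
  qed
  have "measure lebesgue (convex hull Q) \<le> measure lebesgue (\<Union>S\<in>\<S>. convex hull S)"
    using sub meas[of Q] meas fin
    by (intro measure_mono_fmeasurable fmeasurable.finite_UN) (auto simp: \<S>_def)
  also have "\<dots> \<le> (\<Sum>S\<in>\<S>. measure lebesgue (convex hull S))"
    using meas fin by (intro measure_UNION_le) (auto simp: \<S>_def)
  also have "\<dots> \<le> (\<Sum>S\<in>\<S>. B)" by (intro sum_mono B) (auto simp: \<S>_def)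
  also have "\<dots> \<le> 2 ^ card Q * B"
  proof -
    have "card \<S> \<le> card (Pow Q)" using Q(1) by (intro card_mono) (auto simp: \<S>_def)
    then have "real (card \<S>) \<le> 2 ^ card Q" using Q(1) by (simp add: card_Pow flip: of_nat_power)
    then show ?thesis using \<open>0 \<le> B\<close> by (simp add: mult_right_mono)
  qed
  finally show ?thesis .
qed

lemma orthonormal_change_det:
  fixes M :: "real ^ 'd ^ 'd::finite" and h :: "'d \<Rightarrow> nat"
  assumes e: "orthonormal_frame e" and h: "bij_betw h UNIV {..<CARD('d)}"
  shows "\<bar>det M\<bar> = \<bar>det (\<chi> p q. M $ p \<bullet> e (h q))\<bar>"
proof -
  define E :: "real ^ 'd ^ 'd" where "E = (\<chi> a b. e (h b) $ a)"
  have h_less: "h q < CARD('d)" for q using bij_betwE[OF h] by auto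
  have h_eq: "h p = h q \<longleftrightarrow> p = q" for p q
    using bij_betw_imp_inj_on[OF h] by (auto simp: inj_on_def)
  have "transpose E ** E = mat 1"
  proof -
    have "e (h p) \<bullet> e (h q) = (if p = q then 1 else 0)" for p q
      using e h_less h_eq by (auto simp: orthonormal_frame_def)
    then show ?thesis
      by (simp add: E_def matrix_matrix_mult_def transpose_def mat_def vec_eq_iff inner_vec_def)
  qed
  then have "orthogonal_matrix E" by (simp add: orthogonal_matrix)
  then have "\<bar>det E\<bar> = 1" using det_orthogonal_matrix by fastforce
  moreover have "(\<chi> p q. M $ p \<bullet> e (h q)) = M ** E"
    by (simp add: E_def matrix_matrix_mult_def vec_eq_iff inner_vec_def)
  ultimately show ?thesis by (simp add: det_mul abs_mult)
qed

text \<open>The points of the simplex are sorted by their position in the configuration; the determinant of the consecutive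
differences is then expanded in the frame of the configuration.\<close>

lemma measure_simplex_of_flag_configuration:
  fixes e :: "nat \<Rightarrow> real ^ 'd::finite"
  assumes conf: "flag_configuration c s A t x e"
    and s: "\<And>l. l < t \<Longrightarrow> 0 \<le> s l \<and> s l \<le> 1" and c: "c > 0"
    and A: "mono A" "A t = CARD('d) + 1 + m"
    and inj: "inj_on x {..<A t}"
    and diam: "\<And>i i'. i < A t \<Longrightarrow> i' < A t \<Longrightarrow> norm (x i - x i') \<le> c"
    and S: "S \<subseteq> x ` {..<A t}" "card S = CARD('d) + 1"
  shows "measure lebesgue (convex hull S) \<le>
    fact CARD('d) * (c ^ CARD('d) * (\<Prod>l<t. s l ^ (A (Suc l) - A l - (m + 1))))"
proof -
  define d where "d = CARD('d)"
  let ?bd = "c ^ d * (\<Prod>l<t. s l ^ (A (Suc l) - A l - (m + 1)))"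
  define I where "I = {i. i < A t \<and> x i \<in> S}"
  have xI: "x ` I = S" using S(1) by (auto simp: I_def)
  have injI: "inj_on x I" by (rule inj_on_subset[OF inj]) (auto simp: I_def)
  have I: "finite I" "card I = d + 1"
    using card_image[OF injI] S(2) unfolding xI by (auto simp: d_def I_def)
  define y where "y p = sorted_list_of_set I ! p" for p
  have len: "length (sorted_list_of_set I) = d + 1" using I by simp
  have y_mono: "strict_mono_on {..d} y"
    using strict_sorted_list_of_set[of I] len
    by (auto simp: strict_mono_on_def y_def sorted_wrt_nth_less)
  have y_img: "y ` {..d} = I"
  proof -
    have "y ` {..<d + 1} = set (sorted_list_of_set I)"
      unfolding y_def using len by (metis (no_types, lifting) list.set_map map_nth set_upt lessThan_atLeast0 map_map image_cong)
    moreover have "{..<d + 1} = {..d}" by auto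
    ultimately show ?thesis using I(1) by simp
  qed
  have "y d \<in> I" using y_img by auto
  then have yd: "y d < A t" by (simp add: I_def)
  define z where "z p = x (y p)" for p
  have z_img: "z ` {..d} = S" using xI y_img by (auto simp: z_def)
  have z_inj: "inj_on z {..d}"
    using S(2) z_img by (intro eq_card_imp_inj_on) (auto simp: d_def)
  obtain h :: "'d \<Rightarrow> nat" where h: "bij_betw h UNIV {..<d}"
    using ex_bij_betw_finite_nat[of "UNIV :: 'd set"] by (auto simp: d_def lessThan_atLeast0)
  define h' where "h' = inv_into UNIV h"
  have h': "bij_betw h' {..<d} UNIV" unfolding h'_def by (rule bij_betw_inv_into[OF h])
  have h'h: "h' (h p) = p" for p unfolding h'_def by (rule bij_betw_inv_into_left[OF h]) auto
  have e: "orthonormal_frame e" using conf by (simp add: flag_configuration_def)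
  define W :: "real ^ 'd ^ 'd" where "W = (\<chi> p q. (z (Suc (h p)) - z (h p)) \<bullet> e (h q))"
  have term_le: "(\<Prod>p\<in>UNIV. \<bar>W $ p $ \<pi> p\<bar>) \<le> ?bd" if \<pi>: "\<pi> permutes UNIV" for \<pi>
  proof -
    define \<sigma> where "\<sigma> = h \<circ> (\<pi> \<circ> h')"
    have \<sigma>: "bij_betw \<sigma> {..<d} {..<d}" unfolding \<sigma>_def
      by (rule bij_betw_trans[OF bij_betw_trans[OF h' permutes_imp_bij[OF \<pi>]] h])
    have "(\<Prod>p\<in>UNIV. \<bar>W $ p $ \<pi> p\<bar>) = (\<Prod>p\<in>UNIV. \<bar>(z (Suc (h p)) - z (h p)) \<bullet> e (\<sigma> (h p))\<bar>)"
      by (simp add: W_def \<sigma>_def h'h)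
    also have "\<dots> = (\<Prod>p<d. \<bar>(z (Suc p) - z p) \<bullet> e (\<sigma> p)\<bar>)"
      by (rule prod.reindex_bij_betw[OF h, of "\<lambda>p. \<bar>(z (Suc p) - z p) \<bullet> e (\<sigma> p)\<bar>"])
    also have "\<dots> \<le> ?bd" unfolding z_def d_def
    proof (rule leibniz_term_bound[OF conf s c A])
      show "strict_mono_on {..CARD('d)} y" "y CARD('d) < A t"
        using y_mono yd by (auto simp: d_def)
      show "\<sigma> ` {..<CARD('d)} \<subseteq> {..<CARD('d)}" "inj_on \<sigma> {..<CARD('d)}"
        using \<sigma> by (auto simp: bij_betw_def d_def)
    qed (use diam in auto)
    finally show ?thesis .
  qed
  have "measure lebesgue (convex hull S) \<le> \<bar>det (\<chi> p. z (Suc (h p)) - z (h p))\<bar>"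
    using measure_simplex_le_det[of h z] h z_inj z_img by (simp add: d_def)
  also have "\<dots> = \<bar>det W\<bar>"
    using orthonormal_change_det[OF e, of h "\<chi> p. z (Suc (h p)) - z (h p)"] h
    by (simp add: W_def d_def)
  also have "\<dots> \<le> (\<Sum>\<pi> | \<pi> permutes (UNIV :: 'd set). \<bar>of_int (sign \<pi>) * (\<Prod>p\<in>UNIV. W $ p $ \<pi> p)\<bar>)"
    unfolding det_def by (rule sum_abs)
  also have "\<dots> \<le> (\<Sum>\<pi> | \<pi> permutes (UNIV :: 'd set). ?bd)"
  proof (intro sum_mono)
    fix \<pi> :: "'d \<Rightarrow> 'd" assume "\<pi> \<in> {\<pi>. \<pi> permutes UNIV}"
    then have "(\<Prod>p\<in>UNIV. \<bar>W $ p $ \<pi> p\<bar>) \<le> ?bd" using term_le by simp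
    moreover have "\<bar>of_int (sign \<pi>) * (\<Prod>p\<in>UNIV. W $ p $ \<pi> p)\<bar> = (\<Prod>p\<in>UNIV. \<bar>W $ p $ \<pi> p\<bar>)"
      by (simp add: abs_mult sign_def abs_prod)
    ultimately show "\<bar>of_int (sign \<pi>) * (\<Prod>p\<in>UNIV. W $ p $ \<pi> p)\<bar> \<le> ?bd" by simp
  qed
  also have "\<dots> = fact d * ?bd"
    using card_permutations[of "UNIV :: 'd set" d] by (simp add: d_def)
  finally show ?thesis by (simp add: d_def)
qed

section \<open>Upper bounds from block sequences\<close>

text \<open>Here \<open>r\<close> is the number of homogeneous coordinates, \<open>d + 1\<close> for the whole problem. The blocks end at
\<open>r + m\<close> rather than \<open>r\<close> because \<open>m\<close> points more than the vertices of a simplex are chosen. Keeping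
\<open>r\<close> variable allows sequences of blocks to be built from the end.\<close>

definition block_exponent :: "nat \<Rightarrow> nat \<Rightarrow> real \<Rightarrow> bool" where
  "block_exponent m r V \<longleftrightarrow> (\<exists>A t. mono A \<and> A 0 = 0 \<and> (\<forall>l<t. A l < r) \<and> A t = r + m \<and>
     V \<le> (\<Sum>l<t. real (A (Suc l) - A l - (m + 1)) / (real r - real (A l))))"

lemma heilbronn_le_of_block_exponent:
  assumes "block_exponent m (CARD('d::finite) + 1) V"
  shows "\<exists>C>0. \<forall>n\<ge>CARD('d) + 1 + m. heilbronn TYPE('d) (CARD('d) + 1 + m) n \<le> C * real n powr (- V)"
proof -
  obtain A t where A: "mono A" "A 0 = 0" "\<And>l. l < t \<Longrightarrow> A l \<le> CARD('d)" "A t = CARD('d) + 1 + m"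
    and V: "V \<le> (\<Sum>l<t. real (A (Suc l) - A l - (m + 1)) / (real (CARD('d) + 1) - real (A l)))"
    using assms unfolding block_exponent_def by (auto simp: less_Suc_eq_le)
  define d k where "d = CARD('d)" and "k = CARD('d) + 1 + m"
  define c where "c = 4 * real d * (real d + 1) * real k"
  define C where "C = 2 ^ k * (fact d * c ^ d)"
  have d: "d > 0" by (simp add: d_def)
  have c: "c > 0" using d by (simp add: c_def k_def)
  have c_ge: "2 * real d \<le> c"
  proof -
    have "1 * 1 \<le> (real d + 1) * real k" using d by (intro mult_mono) (auto simp: k_def)
    then have "4 * real d * 1 \<le> 4 * real d * ((real d + 1) * real k)" by (intro mult_left_mono) auto
    also have "4 * real d * ((real d + 1) * real k) = c" by (simp add: c_def)
    finally show ?thesis by linarith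
  qed
  have "heilbronn TYPE('d) k n \<le> C * real n powr (- V)" if n: "n \<ge> k" for n
  proof (rule heilbronn_least(2)[OF n], unfold small_hull_bound_def, intro allI impI)
    fix P :: "(real ^ 'd) set"
    assume P: "finite P \<and> card P = n \<and> P \<subseteq> cbox 0 1"
    let ?s = "\<lambda>l. block_scale n d (A l)"
    have n0: "n > 0" using n by (simp add: k_def)
    obtain x and e :: "nat \<Rightarrow> real ^ 'd" where x: "inj_on x {..<k}" "x ` {..<k} \<subseteq> P"
      and conf: "flag_configuration c ?s A t x e"
      using flag_configuration_exists[of P k A t] P n A by (auto simp: c_def d_def k_def)
    define Q where "Q = x ` {..<k}"
    have Q: "finite Q" "card Q = k" "Q \<subseteq> P" using x card_image[OF x(1)] by (auto simp: Q_def)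
    have At: "A t = k" by (simp add: A(4) k_def)
    have s: "0 < ?s l" "?s l \<le> 1" if "l < t" for l
      using block_scale_bounds[OF n0, of "A l" d] A(3)[OF that] by (auto simp: d_def)
    have diam: "norm (x i - x i') \<le> c" if "i < k" "i' < k" for i i'
    proof -
      have "norm (x i - x i') \<le> norm (x i) + norm (x i')" by (rule norm_triangle_ineq4)
      also have "\<dots> \<le> real d + real d"
        unfolding d_def using that x(2) P by (intro add_mono norm_unit_cube_le) auto
      finally show ?thesis using c_ge by simp
    qed
    have "measure lebesgue (convex hull Q) \<le>
        2 ^ card Q * (fact d * (c ^ d * (\<Prod>l<t. ?s l ^ (A (Suc l) - A l - (m + 1)))))"
    proof (rule measure_convex_hull_le_simplices)
      fix S assume "S \<subseteq> Q" "card S = CARD('d) + 1"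
      then show "measure lebesgue (convex hull S) \<le>
          fact d * (c ^ d * (\<Prod>l<t. ?s l ^ (A (Suc l) - A l - (m + 1))))"
        unfolding d_def using conf s x(1) diam c A
        by (intro measure_simplex_of_flag_configuration[where x = x and e = e])
          (auto simp: At Q_def d_def less_imp_le k_def)
    qed (use Q in \<open>auto simp: k_def\<close>)
    also have "(\<Prod>l<t. ?s l ^ (A (Suc l) - A l - (m + 1))) =
        (\<Prod>l<t. real n powr (- (real (A (Suc l) - A l - (m + 1)) / (real (d + 1) - real (A l)))))"
      using n0 by (intro prod.cong refl) (simp add: block_scale_def powr_power mult.commute)
    also have "\<dots> = real n powr (\<Sum>l<t. - (real (A (Suc l) - A l - (m + 1)) / (real (d + 1) - real (A l))))"
      using n0 by (subst powr_sum) auto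
    also have "2 ^ card Q * (fact d * (c ^ d * \<dots>)) \<le> 2 ^ card Q * (fact d * (c ^ d * real n powr (- V)))"
      using c n0 V by (intro mult_left_mono powr_mono) (auto simp: sum_negf d_def)
    finally have "measure lebesgue (convex hull Q) \<le> C * real n powr (- V)"
      by (simp add: C_def Q(2) mult.assoc)
    then show "\<exists>Q\<subseteq>P. card Q = k \<and> measure lebesgue (convex hull Q) \<le> C * real n powr (- V)"
      using Q by blast
  qed
  moreover have "C > 0" using c by (simp add: C_def)
  ultimately show ?thesis unfolding k_def by blast
qed

section \<open>Choice of the block sizes\<close>

lemma block_exponent_single:
  assumes "r > 0"
  shows "block_exponent m r ((real r - 1) / real r)"
  unfolding block_exponent_def
  by (rule exI[of _ "\<lambda>l. if l = 0 then 0 else r + m"], rule exI[of _ 1])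
    (use assms in \<open>auto simp: mono_def of_nat_diff\<close>)

text \<open>A block put in front of the others leaves their scales unchanged, since these depend only on the number of coordinates
that remain.\<close>

lemma block_exponent_add:
  assumes V: "block_exponent m r V" and r: "r > 0"
  shows "block_exponent m (a + r) ((real a - real (m + 1)) / real (a + r) + V)"
proof -
  obtain A t where A: "mono A" "A 0 = 0" "\<And>l. l < t \<Longrightarrow> A l < r" "A t = r + m"
    "V \<le> (\<Sum>l<t. real (A (Suc l) - A l - (m + 1)) / (real r - real (A l)))"
    using V unfolding block_exponent_def by blast
  define A' where "A' l = (case l of 0 \<Rightarrow> 0 | Suc l' \<Rightarrow> a + A l')" for l
  have "mono A'"
    using A(1) by (auto simp: A'_def mono_def split: nat.split)
  moreover have "\<forall>l<Suc t. A' l < a + r" using A(3) r by (auto simp: A'_def split: nat.split)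
  moreover have "A' (Suc t) = (a + r) + m" "A' 0 = 0" using A(4) by (auto simp: A'_def)
  moreover have "(real a - real (m + 1)) / real (a + r) + V \<le>
      (\<Sum>l<Suc t. real (A' (Suc l) - A' l - (m + 1)) / (real (a + r) - real (A' l)))"
  proof -
    have "(\<Sum>l<Suc t. real (A' (Suc l) - A' l - (m + 1)) / (real (a + r) - real (A' l))) =
        real (a - (m + 1)) / real (a + r) + (\<Sum>l<t. real (A (Suc l) - A l - (m + 1)) / (real r - real (A l)))"
      unfolding sum.lessThan_Suc_shift using A(2) by (simp add: A'_def)
    moreover have "(real a - real (m + 1)) / real (a + r) \<le> real (a - (m + 1)) / real (a + r)"
      by (intro divide_right_mono) auto
    ultimately show ?thesis using A(5) by linarith
  qed
  ultimately show ?thesis unfolding block_exponent_def by blast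
qed

text \<open>The successive differences grow linearly in \<open>j\<close>, so that blocks have the order of the square root of
\<open>m + 1\<close> times the number of remaining coordinates.\<close>

definition stage :: "nat \<Rightarrow> nat \<Rightarrow> nat" where
  "stage m j = (m + 1) * (j * (j + 3) div 2)"

lemma stage_Suc: "stage m (Suc j) = (m + 1) * (j + 2) + stage m j"
proof -
  have "Suc j * (Suc j + 3) = j * (j + 3) + (j + 2) * 2" by (simp add: algebra_simps)
  then have "Suc j * (Suc j + 3) div 2 = j * (j + 3) div 2 + (j + 2)" by simp
  then show ?thesis by (simp add: stage_def algebra_simps)
qed

lemma stage_real: "real (stage m j) = (real m + 1) * (real j * (real j + 3) / 2)"
  by (induction j) (simp_all add: stage_Suc, simp_all add: stage_def algebra_simps)

text \<open>The constant is the exponent reached at \<open>stage m 1 = 2 * (m + 1)\<close> with a final block for \<open>5\<close> coordinates,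
which gains \<open>4/5\<close>, preceded by a block of \<open>2 * m - 3\<close> points. For large \<open>m\<close> it is close to
\<open>13/10\<close>, whereas a single final block for all \<open>2 * (m + 1)\<close> coordinates has exponent less than \<open>1\<close>,
which is too small for the final estimate.\<close>

definition stage_value :: "nat \<Rightarrow> nat \<Rightarrow> real" where
  "stage_value m j = 13/10 - (5/2) / (real m + 1) + (\<Sum>i<j. 2 / (real i + 5))"

lemma block_exponent_stage:
  assumes "m \<ge> 2"
  shows "block_exponent m (stage m (Suc j)) (stage_value m j)"
proof (induction j)
  case 0
  have s1: "stage m (Suc 0) = (2 * m - 3) + 5" using assms by (simp add: stage_def)
  have eq: "(real (2 * m - 3) - real (m + 1)) / real (2 * m - 3 + 5) + (real 5 - 1) / real 5 = stage_value m 0"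
    using assms by (simp add: stage_value_def of_nat_diff field_simps)
  show ?case
    using block_exponent_add[OF block_exponent_single[of 5 m], of "2 * m - 3"] unfolding s1 eq by simp
next
  case (Suc j)
  have pos: "stage m (Suc j) > 0" by (simp add: stage_Suc)
  have "real ((m + 1) * (j + 3)) - real (m + 1) = (real m + 1) * (real j + 2)"
    by (simp add: algebra_simps)
  moreover have "real ((m + 1) * (j + 3) + stage m (Suc j)) = (real m + 1) * ((real j + 2) * (real j + 5) / 2)"
    by (simp add: stage_real algebra_simps)
  moreover have "(real m + 1) * (real j + 2) / ((real m + 1) * ((real j + 2) * (real j + 5) / 2)) = 2 / (real j + 5)"
  proof -
    have "(real m + 1) * (real j + 2) \<noteq> 0" by (simp add: add_nonneg_eq_0_iff)
    then show ?thesis by (simp add: divide_simps mult.assoc)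
  qed
  ultimately have "(real ((m + 1) * (j + 3)) - real (m + 1)) / real ((m + 1) * (j + 3) + stage m (Suc j)) = 2 / (real j + 5)"
    by (simp only:)
  then have "(real ((m + 1) * (j + 3)) - real (m + 1)) / real ((m + 1) * (j + 3) + stage m (Suc j)) +
      stage_value m j = stage_value m (Suc j)" by (simp add: stage_value_def)
  moreover have "stage m (Suc (Suc j)) = (m + 1) * (j + 3) + stage m (Suc j)"
    using stage_Suc[of m "Suc j"] by (simp add: algebra_simps)
  ultimately show ?case using block_exponent_add[OF Suc pos, of "(m + 1) * (j + 3)"] by simp
qed

lemma stage_sandwich: "\<exists>J. stage m J \<le> r \<and> r < stage m (Suc J)"
proof -
  have ge: "j \<le> stage m j" for j
  proof (induction j)
    case (Suc j)
    have "1 \<le> (m + 1) * (j + 2)" by simp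
    then show ?case using Suc.IH unfolding stage_Suc by linarith
  qed simp
  define J where "J = (LEAST j. r < stage m (Suc j))"
  have "r < stage m (Suc r)" using ge[of "Suc r"] by simp
  then have "r < stage m (Suc J)" unfolding J_def by (rule LeastI)
  moreover have "stage m J \<le> r"
  proof (cases J)
    case 0
    then show ?thesis by (simp add: stage_def)
  next
    case (Suc j)
    then have "\<not> r < stage m (Suc j)" using not_less_Least[of j "\<lambda>j. r < stage m (Suc j)"] by (simp add: J_def)
    then show ?thesis using Suc by simp
  qed
  ultimately show ?thesis by blast
qed

text \<open>With the symmetric shifts \<open>1/2\<close> the difference of logarithms exceeds \<open>1 / x\<close> by a term of order
\<open>1 / x ^ 3\<close>; moving both arguments up by \<open>1/20\<close> compensates for it from \<open>9/2\<close> on.\<close>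

lemma ln_ratio_le_inverse:
  fixes x :: real
  assumes "x \<ge> 9/2"
  shows "ln (x + 11/20) - ln (x - 9/20) \<le> 1 / x"
proof -
  have "(x + 11/20) / (x - 9/20) \<le> 1 + 1/x + (1/x)\<^sup>2 / 2"
  proof -
    have "(1 + 1/x + (1/x)\<^sup>2 / 2) * (x - 9/20) - (x + 11/20) = (x - 9/2) / (20 * x\<^sup>2)"
      using assms by (simp add: field_simps power2_eq_square)
    also have "\<dots> \<ge> 0" using assms by simp
    finally show ?thesis using assms by (simp add: divide_le_eq)
  qed
  also have "\<dots> \<le> exp (1 / x)" using assms by (intro exp_lower_Taylor_quadratic) simp
  finally have "ln ((x + 11/20) / (x - 9/20)) \<le> ln (exp (1 / x))"
    using assms by (subst ln_le_cancel_iff) auto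
  then show ?thesis using assms by (simp add: ln_div)
qed

lemma ln_numerics:
  shows "693/1000 \<le> ln (2 :: real)"
    and "ln (91/20 :: real) \<le> 15165/10000"
    and "ln (5 :: real) \<le> 16366/10000"
    and "219/100 \<le> ln (9 :: real)" "ln (9 :: real) \<le> 11/5"
    and "2883/1000 \<le> ln (18 :: real)" "46/10 \<le> ln (128 :: real)"
proof -
  have l2: "693/1000 \<le> ln (2 :: real)" "ln (2 :: real) \<le> 6933/10000"
    using ln_approx_bounds[of 2 3] by (simp_all add: eval_nat_numeral)
  have l3: "1095/1000 \<le> ln (3 :: real)" "ln (3 :: real) \<le> 11/10"
    using ln_approx_bounds[of 3 3] by (simp_all add: eval_nat_numeral)
  have "ln (91/80 :: real) \<le> 129/1000"
    using ln_approx_bounds[of "91/80" 1] by (simp add: eval_nat_numeral)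
  then show "ln (91/20 :: real) \<le> 15165/10000"
    using ln_mult_pos[of 2 "91/40 :: real"] ln_mult_pos[of 2 "91/80 :: real"] l2 by simp
  show "ln (5 :: real) \<le> 16366/10000"
    using ln_mult_pos[of 2 "5/2 :: real"] ln_mult_pos[of 2 "5/4 :: real"] l2
      ln_add_one_self_le_self[of "1/4 :: real"] by simp
  have l9: "ln (9 :: real) = 2 * ln 3" using ln_mult_pos[of 3 "3 :: real"] by simp
  then show "219/100 \<le> ln (9 :: real)" "ln (9 :: real) \<le> 11/5" using l3 by simp_all
  show "2883/1000 \<le> ln (18 :: real)" using ln_mult_pos[of 2 "9 :: real"] l9 l2 l3 by simp
  show "46/10 \<le> ln (128 :: real)" using ln_realpow[of 2 7] l2 by simp
  show "693/1000 \<le> ln (2 :: real)" by (rule l2)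
qed

lemma stage_value_ge:
  "stage_value m j \<ge> 13/10 - (5/2) / (real m + 1) + 2 * (ln (real j + 91/20) - ln (91/20))"
proof (induction j)
  case (Suc j)
  have "ln (real j + 5 + 11/20) - ln (real j + 5 - 9/20) \<le> 1 / (real j + 5)"
    by (rule ln_ratio_le_inverse) simp
  then show ?case using Suc.IH by (simp add: stage_value_def add.commute)
qed (simp add: stage_value_def)

text \<open>The ratio \<open>d / m\<close> is compared with \<open>x = (d + 1) / (m + 1)\<close>, the natural variable for the block sizes.\<close>

lemma target_exponent_le:
  fixes q L :: real
  assumes m: "m \<ge> 2" and d: "d \<ge> 1" and L: "ln ((real d + 1) / (real m + 1)) \<le> L"
  defines "q \<equiv> 1 / real m"
  shows "(1 - 1 / real m) * (ln (real d / real m) - 1.1) \<le> (1 - q) * (L + q - 11/10)"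
proof -
  have "(real d + 1) / (real m + 1) * (1 + 1 / real m) = (real d + 1) / real m"
  proof -
    have "1 + 1 / real m = (real m + 1) / real m" using m by (simp add: field_simps)
    then show ?thesis by simp
  qed
  then have "ln (real d / real m) \<le> ln ((real d + 1) / (real m + 1) * (1 + 1 / real m))"
    using m d by (simp add: divide_right_mono)
  also have "\<dots> = ln ((real d + 1) / (real m + 1)) + ln (1 + 1 / real m)"
    using m d by (intro ln_mult_pos) (auto simp: add_pos_pos)
  also have "ln (1 + 1 / real m) \<le> 1 / real m" by (rule ln_add_one_self_le_self) simp
  finally have "ln (real d / real m) \<le> L + q" using L by (simp add: q_def)
  then show ?thesis unfolding q_def using m by (intro mult_left_mono) auto
qed

text \<open>This settles \<open>J = 2\<close>, where \<open>5 \<le> x \<le> 9\<close> and \<open>ln 9 \<le> 11/5\<close>.\<close>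

lemma small_stage_inequality:
  fixes q y :: real
  assumes q: "0 < q" "q \<le> 1/2" and y: "y = q / (1 + q)"
  shows "(1 - q) * (11/5 + q - 11/10) \<le> 17/10 - (5/2) * y"
proof -
  have "(5/2) * q \<le> (6/10 + q / 10 + q\<^sup>2) * (1 + q)"
  proof -
    have "(6/10 + q / 10 + q\<^sup>2) * (1 + q) - (5/2) * q = 6/10 - 18/10 * q + 11/10 * q\<^sup>2 + q ^ 3"
      by (simp add: power2_eq_square power3_eq_cube field_simps)
    \<comment> \<open>This product agrees with the cubic in the two leading coefficients; the difference is linear and nonnegative.\<close>
    moreover have "0 \<le> (1/2 - q)\<^sup>2 * (q + 21/10)"
      using q by (intro mult_nonneg_nonneg) auto
    moreover have "(1/2 - q)\<^sup>2 * (q + 21/10) = q ^ 3 + 11/10 * q\<^sup>2 - 37/20 * q + 21/40"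
      by (simp add: power2_eq_square power3_eq_cube field_simps)
    ultimately show ?thesis using q by linarith
  qed
  then have "(5/2) * q / (1 + q) \<le> 6/10 + q / 10 + q\<^sup>2" using q by (subst pos_divide_le_eq) auto
  then have "(5/2) * y \<le> 6/10 + q / 10 + q\<^sup>2" by (simp add: y)
  moreover have "(1 - q) * (11/5 + q - 11/10) = 11/10 - q / 10 - q\<^sup>2"
    by (simp add: power2_eq_square field_simps)
  ultimately show ?thesis by linarith
qed

text \<open>The terms with \<open>x\<close> and \<open>J\<close> are governed by \<open>w = (J + 51/20)\<^sup>2 / x\<close>, because
\<open>2 * ln (J + 51/20) - ln x = ln w\<close> and \<open>J * (J + 1) / (2 * x) = \<kappa> * w\<close>. The function
\<open>ln w - \<kappa> * w\<close> is increasing on \<open>2 \<le> w \<le> 1 / \<kappa>\<close>, so its value at \<open>2\<close> is a lower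
bound. The remainder is quadratic in \<open>q = 1 / m\<close>; it is at most \<open>0\<close> once \<open>ln x \<ge> 46/10\<close>, and for smaller
\<open>x\<close> it is dominated by the gap \<open>1 - 2 * \<kappa>\<close>, which is of the order \<open>4 / J\<close>.\<close>

lemma large_stage_inequality:
  fixes J :: nat and x q y :: real
  assumes J: "J \<ge> 3" and x: "real J * (real J + 3) / 2 \<le> x" "x \<le> (real J + 1) * (real J + 4) / 2"
    and q: "0 < q" "q \<le> 1/2" and y: "y = q / (1 + q)"
  shows "(1 - q) * (ln x + q - 11/10) \<le>
    23/10 - (5/2) * y + 2 * (ln (real J + 51/20) - ln (91/20)) - real J * (real J + 1) / (2 * x)"
proof -
  define j where "j = real J"
  have j: "j \<ge> 3" using J by (simp add: j_def)
  have xj: "j * (j + 3) / 2 \<le> x" "x \<le> (j + 1) * (j + 4) / 2" using x by (auto simp: j_def)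
  have "3 * 6 \<le> j * (j + 3)" using j by (intro mult_mono) auto
  then have x9: "x \<ge> 9" using xj(1) by simp
  define w where "w = (j + 51/20)\<^sup>2 / x"
  define \<kappa> where "\<kappa> = j * (j + 1) / (2 * (j + 51/20)\<^sup>2)"
  have w2: "w \<ge> 2"
  proof -
    have "2 * x \<le> (j + 51/20)\<^sup>2" using xj(2) j by (simp add: power2_eq_square algebra_simps)
    then show ?thesis using x9 by (simp add: w_def le_divide_eq)
  qed
  have \<kappa>w: "\<kappa> * w = j * (j + 1) / (2 * x)"
    using j x9 by (simp add: \<kappa>_def w_def)
  have \<kappa>w_le: "\<kappa> * w \<le> 1"
  proof -
    have "j * (j + 1) \<le> j * (j + 3)" using j by (intro mult_left_mono) auto
    then show ?thesis unfolding \<kappa>w using x9 xj(1) by (simp add: divide_le_eq)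
  qed
  have "ln (2 / w) \<le> 2 / w - 1" using w2 by (intro ln_le_minus_one) auto
  moreover have "ln (2 / w) = ln 2 - ln w" using w2 by (simp add: ln_div)
  ultimately have ln_w: "ln w \<ge> ln 2 + 1 - 2 / w" by linarith
  have "\<kappa> * w - 2 * \<kappa> = (\<kappa> * w) * ((w - 2) / w)" using w2 by (simp add: field_simps)
  also have "\<dots> \<le> 1 * ((w - 2) / w)" using \<kappa>w_le w2 by (intro mult_right_mono) auto
  also have "\<dots> = 1 - 2 / w" using w2 by (simp add: field_simps)
  finally have tangent: "\<kappa> * w \<le> 2 * \<kappa> + 1 - 2 / w" by linarith
  have "ln w = ln ((j + 51/20)\<^sup>2) - ln x" unfolding w_def using j x9 by (simp add: ln_div)
  also have "ln ((j + 51/20)\<^sup>2) = 2 * ln (j + 51/20)" using j by (simp add: ln_realpow)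
  finally have main: "2 * ln (j + 51/20) - j * (j + 1) / (2 * x) \<ge> ln x + ln 2 - 2 * \<kappa>"
    using ln_w tangent \<kappa>w by linarith
  \<comment> \<open>The convex function \<open>1 / (1 + q)\<close> lies below its chord on \<open>[0, 1/2]\<close>.\<close>
  have rational: "(5/2) * y + q * (21/10 - ln x) - q\<^sup>2 \<le> q * (46/10 - ln x) - (8/3) * q\<^sup>2"
  proof -
    have "(5/2) * q \<le> ((5/2) * q - (5/3) * q\<^sup>2) * (1 + q)"
    proof -
      have "((5/2) * q - (5/3) * q\<^sup>2) * (1 + q) - (5/2) * q = (5/3) * q\<^sup>2 * (1/2 - q)"
        by (simp add: power2_eq_square field_simps)
      moreover have "\<dots> \<ge> 0" using q by simp
      ultimately show ?thesis by linarith
    qed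
    then have "(5/2) * q / (1 + q) \<le> (5/2) * q - (5/3) * q\<^sup>2" using q by (subst pos_divide_le_eq) auto
    then have "(5/2) * y \<le> (5/2) * q - (5/3) * q\<^sup>2" by (simp add: y)
    then show ?thesis by (simp add: algebra_simps)
  qed
  have quad: "q * B - (8/3) * q\<^sup>2 \<le> 3/32 * B\<^sup>2" for B
  proof -
    have "0 \<le> (8/3) * (q - 3/16 * B)\<^sup>2" by simp
    then show ?thesis by (simp add: power2_eq_square algebra_simps)
  qed
  have bound: "q * (46/10 - ln x) - (8/3) * q\<^sup>2 \<le> 106/100 - 2 * \<kappa>"
  proof -
    have mono_B: "q * (46/10 - ln x) - (8/3) * q\<^sup>2 \<le> 3/32 * B\<^sup>2" if "46/10 - B \<le> ln x" for B
      using quad[of B] mult_left_mono[of "46/10 - ln x" B q] that q by linarith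
    have \<kappa>_le: "2 * \<kappa> \<le> c" if "j * (j + 1) \<le> c * (j + 51/20)\<^sup>2" for c
      using that j by (simp add: \<kappa>_def divide_le_eq)
    have x_ge: "ln c \<le> ln x" if "0 < c" "c \<le> j * (j + 3) / 2" for c
      using that xj(1) by (subst ln_le_cancel_iff) auto
    consider "J \<le> 4" | "5 \<le> J" "J \<le> 14" | "15 \<le> J" by linarith
    then show ?thesis
    proof cases
      case 1
      have "ln 9 \<le> ln x" using x9 by simp
      then have "219/100 \<le> ln x" using ln_numerics(4) by linarith
      then have "q * (46/10 - ln x) - (8/3) * q\<^sup>2 \<le> 3/32 * (241/100)\<^sup>2" by (intro mono_B) simp
      moreover have "2 * \<kappa> \<le> 47/100"
      proof (rule \<kappa>_le)
        have "J = 3 \<or> J = 4" using 1 J by auto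
        then show "j * (j + 1) \<le> 47/100 * (j + 51/20)\<^sup>2"
          by (auto simp: j_def power2_eq_square)
      qed
      ultimately show ?thesis by (simp add: power2_eq_square)
    next
      case 2
      have "5 * 8 \<le> j * (j + 3)" using 2 by (intro mult_mono) (auto simp: j_def)
      then have "ln 18 \<le> ln x" by (intro x_ge) auto
      then have "2883/1000 \<le> ln x" using ln_numerics(6) by linarith
      then have "q * (46/10 - ln x) - (8/3) * q\<^sup>2 \<le> 3/32 * (1717/1000)\<^sup>2" by (intro mono_B) simp
      moreover have "2 * \<kappa> \<le> 77/100"
      proof (rule \<kappa>_le)
        have j14: "j \<le> 14" using 2 by (simp add: j_def)
        then have "j * j \<le> 14 * j" using j by (intro mult_right_mono) auto
        then have "23/100 * (j * j) \<le> 2927/1000 * j + 200277/40000" using j14 by linarith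
        then show "j * (j + 1) \<le> 77/100 * (j + 51/20)\<^sup>2"
          by (simp add: power2_eq_square field_simps)
      qed
      ultimately show ?thesis by (simp add: power2_eq_square)
    next
      case 3
      have "15 * 18 \<le> j * (j + 3)" using 3 by (intro mult_mono) (auto simp: j_def)
      then have "ln 128 \<le> ln x" by (intro x_ge) auto
      then have "46/10 \<le> ln x" using ln_numerics(7) by linarith
      then have "q * (46/10 - ln x) - (8/3) * q\<^sup>2 \<le> 3/32 * 0\<^sup>2" by (intro mono_B) simp
      moreover have "2 * \<kappa> \<le> 1"
        by (rule \<kappa>_le) (use j in \<open>simp add: power2_eq_square algebra_simps\<close>)
      ultimately show ?thesis by simp
    qed
  qed
  have "(1 - q) * (ln x + q - 11/10) = ln x - 11/10 + q * (21/10 - ln x) - q\<^sup>2"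
    by (simp add: field_simps power2_eq_square)
  also have "\<dots> \<le> 23/10 - (5/2) * y + 2 * (ln (j + 51/20) - ln (91/20)) - j * (j + 1) / (2 * x)"
  proof -
    define B where "B = q * (21/10 - ln x)"
    define T where "T = j * (j + 1) / (2 * x)"
    have "(5/2) * y + B - q\<^sup>2 \<le> 106/100 - 2 * \<kappa>"
      unfolding B_def by (rule order_trans[OF rational bound])
    moreover have "ln x + ln 2 - 2 * \<kappa> \<le> 2 * ln (j + 51/20) - T"
      unfolding T_def by (rule main)
    ultimately show ?thesis
      unfolding B_def[symmetric] T_def[symmetric] using ln_numerics(1,2) by argo
  qed
  finally show ?thesis by (simp add: j_def)
qed

text \<open>Up to \<open>x = 5\<close> a single block is enough. Beyond that, let \<open>stage m J \<le> d + 1 < stage m (J + 1)\<close>. The first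
block is enlarged so that it leads from \<open>d + 1\<close> directly to stage \<open>J - 1\<close>, which interpolates between the stages
with little loss.\<close>

lemma block_exponent_target:
  assumes m: "m \<ge> 2" and d: "d \<ge> m + 1"
  shows "\<exists>V. block_exponent m (d + 1) V \<and> (1 - 1 / real m) * (ln (real d / real m) - 1.1) \<le> V"
proof -
  define r where "r = d + 1"
  define q where "q = 1 / real m"
  define x where "x = real r / (real m + 1)"
  have q: "0 < q" "q \<le> 1/2" using m by (auto simp: q_def field_simps)
  have y: "1 / (real m + 1) = q / (1 + q)" using m by (simp add: q_def field_simps)
  have x_eq: "(real d + 1) / (real m + 1) = x" by (simp add: x_def r_def add.commute)
  have target: "(1 - 1 / real m) * (ln (real d / real m) - 1.1) \<le> (1 - q) * (L + q - 11/10)"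
    if "ln x \<le> L" for L
    using target_exponent_le[OF m, of d L] that d x_eq by (simp add: q_def)
  obtain J where J: "stage m J \<le> r" "r < stage m (Suc J)" using stage_sandwich by blast
  have "real (stage m J) \<le> real r" "real r < real (stage m (Suc J))" using J by simp_all
  then have xJ: "real J * (real J + 3) / 2 \<le> x" "x \<le> (real J + 1) * (real J + 4) / 2"
    unfolding stage_real x_def by (simp_all add: field_simps)
  have x_pos: "x > 0" by (simp add: x_def r_def)
  show ?thesis
  proof (cases "J \<le> 1")
    case True
    have "x \<le> 5" using xJ(2) True by (cases J) auto
    then have "ln x \<le> ln 5" using x_pos by simp
    then have "ln x \<le> 16366/10000" using ln_numerics(3) by linarith
    note target[OF this]
    also have "(1 - q) * (16366/10000 + q - 11/10) \<le> 3/4"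
    proof -
      have "(1 - q) * (16366/10000 + q - 11/10) = 5366/10000 + 4634/10000 * q - q\<^sup>2"
        by (simp add: power2_eq_square field_simps)
      moreover have "q\<^sup>2 - 46/100 * q + 529/10000 = (q - 23/100)\<^sup>2"
        by (simp add: power2_eq_square field_simps)
      ultimately show ?thesis using q zero_le_power2[of "q - 23/100"] by linarith
    qed
    also have "3/4 \<le> (real r - 1) / real r" using m d by (simp add: r_def field_simps)
    finally show ?thesis using block_exponent_single[of r m] by (auto simp: r_def)
  next
    case False
    then obtain i where i: "J = Suc (Suc i)" by (metis One_nat_def le0 le_SucI not0_implies_Suc le_refl)
    have le: "stage m (Suc i) \<le> r" using J(1) by (simp add: i stage_Suc)
    have pos: "stage m (Suc i) > 0" by (simp add: stage_Suc)
    define V where "V = (real (r - stage m (Suc i)) - real (m + 1)) / real (r - stage m (Suc i) + stage m (Suc i)) + stage_value m i"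
    have V: "block_exponent m r V"
      using block_exponent_add[OF block_exponent_stage[OF m] pos, of "r - stage m (Suc i)"] le
      by (simp add: V_def)
    have V_eq: "V = 1 - real J * (real J + 1) / (2 * x) + stage_value m i"
    proof -
      have "real (r - stage m (Suc i)) - real (m + 1) = real r - (real m + 1) * (real J * (real J + 1) / 2)"
        using le by (simp add: of_nat_diff stage_real i algebra_simps)
      moreover have "(real r - (real m + 1) * (real J * (real J + 1) / 2)) / real r =
          1 - real J * (real J + 1) / (2 * x)"
        by (simp add: x_def r_def field_simps)
      ultimately show ?thesis unfolding V_def le_add_diff_inverse2[OF le] by (simp only:)
    qed
    have V_ge: "V \<ge> 23/10 - (5/2) * (q / (1 + q)) + 2 * (ln (real J + 51/20) - ln (91/20))
        - real J * (real J + 1) / (2 * x)"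
    proof -
      have y': "(5/2) / (real m + 1) = (5/2) * (q / (1 + q))" unfolding y[symmetric] by simp
      have ln_eq: "ln (real i + 91/20) = ln (real J + 51/20)" by (simp add: i)
      show ?thesis using stage_value_ge[of m i] unfolding V_eq y' ln_eq by simp
    qed
    have "(1 - 1 / real m) * (ln (real d / real m) - 1.1) \<le> V"
    proof (cases "J = 2")
      case True
      have "x \<le> 9" "5 \<le> x" using xJ True by auto
      have "ln x \<le> ln 9" using \<open>x \<le> 9\<close> x_pos by simp
      then have "ln x \<le> 11/5" using ln_numerics(5) by linarith
      note target[OF this]
      also have "(1 - q) * (11/5 + q - 11/10) \<le> 17/10 - (5/2) * (q / (1 + q))"
        by (rule small_stage_inequality[OF q refl])
      also have "\<dots> \<le> V"
      proof -
        have "real J * (real J + 1) / (2 * x) \<le> 6/10" using True \<open>5 \<le> x\<close> by (simp add: divide_le_eq)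
        then show ?thesis using V_ge True by simp
      qed
      finally show ?thesis .
    next
      case neq: False
      have "J \<ge> 3" using False neq by simp
      note target[OF order_refl]
      also have "(1 - q) * (ln x + q - 11/10) \<le> V"
        using large_stage_inequality[OF \<open>J \<ge> 3\<close> xJ q refl] V_ge by linarith
      finally show ?thesis .
    qed
    then show ?thesis using V by (auto simp: r_def)
  qed
qed

section \<open>The upper bound\<close>

theorem theorem1p6:
  fixes d k :: nat
  assumes "d = CARD('d::finite)" and "d \<ge> 2" and "d + 3 \<le> k" and "k \<le> 2 * d"
  shows "\<exists>C>0. \<forall>n\<ge>k. heilbronn TYPE('d) k n \<le>
    C * real n powr (- ((1 - 1 / (real k - real d - 1)) * (ln (real d / (real k - real d - 1)) - 1.1)))"
proof -
  define m where "m = k - d - 1"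
  have m: "m \<ge> 2" "d \<ge> m + 1" and k: "k = CARD('d) + 1 + m" and real_m: "real k - real d - 1 = real m"
    using assms by (auto simp: m_def)
  obtain V where V: "block_exponent m (d + 1) V" "(1 - 1 / real m) * (ln (real d / real m) - 1.1) \<le> V"
    using block_exponent_target[OF m] by blast
  obtain C where C: "C > 0" "\<And>n. n \<ge> k \<Longrightarrow> heilbronn TYPE('d) k n \<le> C * real n powr (- V)"
    using heilbronn_le_of_block_exponent[where 'd = 'd, of m V] V(1) assms(1) k by auto
  have "heilbronn TYPE('d) k n \<le> C * real n powr (- ((1 - 1 / real m) * (ln (real d / real m) - 1.1)))"
    if "n \<ge> k" for n
  proof -
    have "n \<ge> 1" using that k by simp
    then have "real n powr (- V) \<le> real n powr (- ((1 - 1 / real m) * (ln (real d / real m) - 1.1)))"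
      using V(2) by (intro powr_mono) auto
    then show ?thesis using C(2)[OF that] C(1) by (meson less_imp_le mult_left_mono order_trans)
  qed
  then show ?thesis unfolding real_m using C(1) by blast
qed

end
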